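(* Let $a\in\mathfrak{sl}(n,\mathbb{C})$ be a nonzero diagonal matrix, $b\in\mathfrak{sl}(n,\mathbb{C})$ with $[a,b]=0$, and $j$ a positive integer. Let $u$ be a local solution of the $j$-th flow in the $\mathfrak{sl}(n,\mathbb{C})$-hierarchy defined by $b$, with trivialization $E$, that admits a local reduced wave function $\omega$. Choose $\alpha\in\mathbb{C}$ and a linear map $N:\mathbb{C}^n\to\mathbb{C}^n$ with $N^2=0$. Let $E_1(x,t)=\left.\frac{d}{d\lambda}\right|_{\lambda=\alpha}E(x,t,\lambda)E(x,t,\alpha)^{-1}$ and define $$\tilde N(x,t)=E(x,t,\alpha)^{-1}\bigl(\mathrm{Id}+NE_1(x,t)\bigr)^{-1}NE(x,t,\alpha)$$ wherever this is well-defined (i.e. wherever $\mathrm{Id}+NE_1(x,t)$ is invertible). Then $$\tilde u(x,t)=u(x,t)-[a,\tilde N(x,t)]$$ is another solution of the $j$-th flow. Its trivialization is $$\tilde E(x,t,\lambda)=m_{\alpha,1,N}(\lambda)\,E(x,t,\lambda)\,m_{\alpha,1,\tilde N(x,t)}(\lambda)^{-1},$$ and it has the local reduced wave function $$\tilde\omega(x,t,\lambda)=\omega(x,t,\lambda)\,m_{\alpha,1,\tilde N(x,t)}(\lambda)^{-1}.$$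
   Context: For a linear map $N$ with $N^2=0$, $m_{\alpha,1,N}(\lambda)=\mathrm{Id}+\frac{1}{\lambda-\alpha}N$. ZS–AKNS flows: put $\mathfrak{sl}(n,\mathbb{C})_a^\perp=\{y\in\mathfrak{sl}(n,\mathbb{C}) : \mathrm{tr}(zy)=0\text{ for all } z\in\mathfrak{sl}(n,\mathbb C)\text{ with }[a,z]=0\}$. For $u$ with values in $\mathfrak{sl}(n,\mathbb{C})_a^\perp$ there is (a recalled fact) a unique family of $\mathfrak{sl}(n,\mathbb{C})$-valued maps $Q_{b,i}(u)$, $i\ge0$, with $Q_{b,0}(u)=b$, such that $$(Q_{b,i}(u))_x+[u,Q_{b,i}(u)]=[Q_{b,i+1}(u),a]$$ and the asymptotic expansion $\sum_{i\ge0}Q_{b,i}(u)\lambda^{-i}$ is conjugate to $b$. The $j$-th flow defined by $b$ is the equation $u_t=(Q_{b,j}(u))_x+[u,Q_{b,j}(u)]$; a local solution is a smooth solution $u(x,t)\in\mathfrak{sl}(n,\mathbb{C})_a^\perp$ defined for $(x,t)$ near $(0,0)\in\mathbb{R}^2$. The trivialization of a solution $u$ is the unique $E(x,t,\lambda)$, $\lambda\in\mathbb{C}$, with $$E^{-1}E_x=a\lambda+u,\qquad E^{-1}E_t=b\lambda^j+Q_{b,1}(u)\lambda^{j-1}+\dots+Q_{b,j}(u),\qquad E(0,0,\lambda)=\mathrm{Id}.$$ A local reduced wave function of $u$ is a smooth family $\omega(x,t,\lambda)\in\mathrm{GL}(n,\mathbb{C})$, holomorphic in $\lambda$ in a neighbourhood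 of $\lambda=\infty$ with $\omega(x,t,\infty)=\mathrm{Id}$, such that the trivialization satisfies $$E(x,t,\lambda)=\omega(0,0,\lambda)^{-1}e^{a\lambda x+b\lambda^jt}\,\omega(x,t,\lambda).$$ *)

theory Defs
  imports "HOL-Analysis.Analysis" "HOL-Complex_Analysis.Complex_Analysis"
    "HOL-Computational_Algebra.Formal_Power_Series"
begin

definition cscale :: "complex \<Rightarrow> complex^'n^'n \<Rightarrow> complex^'n^'n"  (infixr "*\<^sub>m" 75)
  where "c *\<^sub>m A = (\<chi> i k. c * A $ i $ k)"

definition commutator :: "complex^'n^'n \<Rightarrow> complex^'n^'n \<Rightarrow> complex^'n^'n"
  where "commutator A B = A ** B - B ** A"

(* The library's * and ^ on vec are componentwise, so its exp does not apply to matrices. *)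
definition matrix_exp :: "complex^'n^'n \<Rightarrow> complex^'n^'n"
  where "matrix_exp A = (\<Sum>k. (1 / fact k) *\<^sub>R (((**) A ^^ k) (mat 1)))"

definition sl :: "(complex^'n^'n) set"
  where "sl = {A. trace A = 0}"

definition sl_perp :: "complex^'n^'n \<Rightarrow> (complex^'n^'n) set"
  where "sl_perp a = {y \<in> sl. \<forall>z\<in>sl. commutator a z = 0 \<longrightarrow> trace (z ** y) = 0}"


(* Intended for open S, where it is the usual class of C^k maps: all iterated directional
   derivatives up to order k exist and are continuous. *)
primrec Ck_on :: "nat \<Rightarrow> 'a::euclidean_space set \<Rightarrow> ('a \<Rightarrow> 'b::real_normed_vector) \<Rightarrow> bool"
  where
    "Ck_on 0 S f \<longleftrightarrow> continuous_on S f"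
  | "Ck_on (Suc k) S f \<longleftrightarrow> (\<forall>x\<in>S. f differentiable (at x)) \<and>
       (\<forall>v. Ck_on k S (\<lambda>x. frechet_derivative f (at x) v))"

definition smooth_on :: "'a::euclidean_space set \<Rightarrow> ('a \<Rightarrow> 'b::real_normed_vector) \<Rightarrow> bool"
  where "smooth_on S f \<longleftrightarrow> (\<forall>k. Ck_on k S f)"

definition matrix_holomorphic_on :: "(complex \<Rightarrow> complex^'n^'n) \<Rightarrow> complex set \<Rightarrow> bool"
  where "matrix_holomorphic_on F S \<longleftrightarrow> (\<forall>i k. (\<lambda>l. F l $ i $ k) holomorphic_on S)"

definition matrix_deriv :: "(complex \<Rightarrow> complex^'n^'n) \<Rightarrow> complex \<Rightarrow> complex^'n^'n"
  where "matrix_deriv F l = (\<chi> i k. deriv (\<lambda>z. F z $ i $ k) l)"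

(* Points (x,t) of the plane are pairs; dx and dt are the partial derivatives. *)
definition dx :: "(real \<times> real \<Rightarrow> 'b::real_normed_vector) \<Rightarrow> real \<times> real \<Rightarrow> 'b"
  where "dx f p = vector_derivative (\<lambda>s. f (s, snd p)) (at (fst p))"

definition dt :: "(real \<times> real \<Rightarrow> 'b::real_normed_vector) \<Rightarrow> real \<times> real \<Rightarrow> 'b"
  where "dt f p = vector_derivative (\<lambda>s. f (fst p, s)) (at (snd p))"


(* The formal variable fps_X of the following series stands for 1/lambda. *)
definition formal_series :: "(nat \<Rightarrow> complex^'n^'n) \<Rightarrow> complex fps^'n^'n"
  where "formal_series A = (\<chi> i k. Abs_fps (\<lambda>m. A m $ i $ k))"

definition formal_const :: "complex^'n^'n \<Rightarrow> complex fps^'n^'n"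
  where "formal_const A = (\<chi> i k. fps_const (A $ i $ k))"

definition formally_conjugate :: "(nat \<Rightarrow> complex^'n^'n) \<Rightarrow> complex^'n^'n \<Rightarrow> bool"
  where "formally_conjugate A b \<longleftrightarrow>
    (\<exists>G. invertible G \<and> formal_series A = G ** formal_const b ** matrix_inv G)"

(* Q i plays the role of Q_{b,i}(u) on U.  It is a relation rather than a function of u, so that
   nothing depends on existence or uniqueness of the family. *)
definition Q_family :: "complex^'n^'n \<Rightarrow> complex^'n^'n \<Rightarrow> (real \<times> real) set \<Rightarrow>
    (real \<times> real \<Rightarrow> complex^'n^'n) \<Rightarrow> (nat \<Rightarrow> real \<times> real \<Rightarrow> complex^'n^'n) \<Rightarrow> bool"
  where "Q_family a b U u Q \<longleftrightarrow>
    (\<forall>i. smooth_on U (Q i)) \<and>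
    (\<forall>p\<in>U. Q 0 p = b \<and>
      (\<forall>i. Q i p \<in> sl \<and> dx (Q i) p + commutator (u p) (Q i p) = commutator (Q (Suc i) p) a) \<and>
      formally_conjugate (\<lambda>i. Q i p) b)"

definition local_solution :: "complex^'n^'n \<Rightarrow> complex^'n^'n \<Rightarrow> nat \<Rightarrow> (real \<times> real) set \<Rightarrow>
    (real \<times> real \<Rightarrow> complex^'n^'n) \<Rightarrow> (nat \<Rightarrow> real \<times> real \<Rightarrow> complex^'n^'n) \<Rightarrow> bool"
  where "local_solution a b j U u Q \<longleftrightarrow>
    open U \<and> (0, 0) \<in> U \<and> smooth_on U u \<and> (\<forall>p\<in>U. u p \<in> sl_perp a) \<and>
    Q_family a b U u Q \<and>
    (\<forall>p\<in>U. dt u p = dx (Q j) p + commutator (u p) (Q j p))"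

(* Joint smoothness and holomorphy in lambda are what linear ODE theory gives for the solution of
   this system normalised at (0,0); they make d/dlambda at a point meaningful, and they determine
   E at a single value of lambda from its values elsewhere. *)
definition trivialization :: "complex^'n^'n \<Rightarrow> complex^'n^'n \<Rightarrow> nat \<Rightarrow> (real \<times> real) set \<Rightarrow>
    (real \<times> real \<Rightarrow> complex^'n^'n) \<Rightarrow> (nat \<Rightarrow> real \<times> real \<Rightarrow> complex^'n^'n) \<Rightarrow>
    (real \<times> real \<Rightarrow> complex \<Rightarrow> complex^'n^'n) \<Rightarrow> bool"
  where "trivialization a b j U u Q E \<longleftrightarrow>
    smooth_on (U \<times> UNIV) (\<lambda>(p, l). E p l) \<and>
    (\<forall>p\<in>U. matrix_holomorphic_on (E p) UNIV) \<and>
    (\<forall>p\<in>U. \<forall>l. invertible (E p l) \<and>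
      matrix_inv (E p l) ** dx (\<lambda>q. E q l) p = l *\<^sub>m a + u p \<and>
      matrix_inv (E p l) ** dt (\<lambda>q. E q l) p =
        l ^ j *\<^sub>m b + (\<Sum>i = 1..j. l ^ (j - i) *\<^sub>m Q i p)) \<and>
    (\<forall>l. E (0, 0) l = mat 1)"

(* The function of (p, z) is w in the coordinate z = 1/lambda near lambda = infinity, extended by
   its prescribed value Id at z = 0; the punctured disc 0 < |z| < r is |lambda| > 1/r.
   Only values w p l with |l| > 1/r matter. *)
definition local_reduced_wave_function :: "complex^'n^'n \<Rightarrow> complex^'n^'n \<Rightarrow> nat \<Rightarrow>
    (real \<times> real) set \<Rightarrow> (real \<times> real \<Rightarrow> complex \<Rightarrow> complex^'n^'n) \<Rightarrow>
    (real \<times> real \<Rightarrow> complex \<Rightarrow> complex^'n^'n) \<Rightarrow> bool"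
  where "local_reduced_wave_function a b j U E w \<longleftrightarrow>
    (\<exists>V r. open V \<and> (0, 0) \<in> V \<and> V \<subseteq> U \<and> r > 0 \<and>
      smooth_on (V \<times> ball 0 r) (\<lambda>(p, z). if z = 0 then mat 1 else w p (1 / z)) \<and>
      (\<forall>p\<in>V. matrix_holomorphic_on (\<lambda>z. if z = 0 then mat 1 else w p (1 / z)) (ball 0 r)) \<and>
      (\<forall>p\<in>V. \<forall>l. norm l > 1 / r \<longrightarrow> invertible (w p l) \<and>
        E p l = matrix_inv (w (0, 0) l) **
          matrix_exp ((l * of_real (fst p)) *\<^sub>m a + (l ^ j * of_real (snd p)) *\<^sub>m b) ** w p l))"


(* m_{alpha,1,N}; only meaningful for l different from alpha. *)
definition m_factor :: "complex \<Rightarrow> complex^'n^'n \<Rightarrow> complex \<Rightarrow> complex^'n^'n"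
  where "m_factor \<alpha> N l = mat 1 + (1 / (l - \<alpha>)) *\<^sub>m N"

definition E1 :: "complex \<Rightarrow> (real \<times> real \<Rightarrow> complex \<Rightarrow> complex^'n^'n) \<Rightarrow> real \<times> real \<Rightarrow> complex^'n^'n"
  where "E1 \<alpha> E p = matrix_deriv (\<lambda>l. E p l ** matrix_inv (E p \<alpha>)) \<alpha>"

definition N_tilde :: "complex \<Rightarrow> complex^'n^'n \<Rightarrow> (real \<times> real \<Rightarrow> complex \<Rightarrow> complex^'n^'n) \<Rightarrow>
    real \<times> real \<Rightarrow> complex^'n^'n"
  where "N_tilde \<alpha> N E p =
    matrix_inv (E p \<alpha>) ** matrix_inv (mat 1 + N ** E1 \<alpha> E p) ** N ** E p \<alpha>"

definition N_tilde_domain :: "complex \<Rightarrow> complex^'n^'n \<Rightarrow>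
    (real \<times> real \<Rightarrow> complex \<Rightarrow> complex^'n^'n) \<Rightarrow> (real \<times> real) set \<Rightarrow> (real \<times> real) set"
  where "N_tilde_domain \<alpha> N E U = {p \<in> U. invertible (mat 1 + N ** E1 \<alpha> E p)}"

end

theory Submission
  imports Defs
begin

text \<open>
  Put \<open>g = E(\<alpha>) + N E'(\<alpha>)\<close>, the derivative taken in \<open>\<lambda>\<close>. Since \<open>N\<^sup>2 = 0\<close>, the new
  nilpotent matrix is the conjugate \<open>g\<^sup>-\<^sup>1 N g\<close>, and exactly this choice cancels the principal part
  at \<open>\<lambda> = \<alpha>\<close> of the dressed frame \<open>m E m'\<^sup>-\<^sup>1\<close>, where \<open>m, m'\<close> are the factors of the old and the
  new matrix. What is left is a combination of divided differences of \<open>E\<close> in \<open>\<lambda>\<close>, which are entire in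
  \<open>\<lambda>\<close> and, by Hadamard's integral formula, jointly smooth. Its determinant is that of \<open>E\<close>, because
  \<open>m\<close> and \<open>m'\<close> are conjugate.

  Both equations of the trivialization have the form \<open>E_v = E A(\<lambda>)\<close> with \<open>A\<close> polynomial in \<open>\<lambda>\<close>, so one
  gauge computation treats them together; equations found for \<open>\<lambda> \<noteq> \<alpha>\<close> extend to \<open>\<alpha>\<close> by continuity,
  which also makes the symmetry of mixed second derivatives unnecessary. The new family \<open>Q'\<close> consists of
  the coefficients of \<open>m' Q m'\<^sup>-\<^sup>1\<close> in powers of \<open>1/\<lambda>\<close>, and the flow equation for the new solution is
  \<open>Q'_(j+1) - Q_(j+1) = \<partial>_t (g\<^sup>-\<^sup>1 N g)\<close>, the \<open>t\<close>-part of the same computation.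
\<close>

subsection \<open>Calculus of \<open>C\<^sup>k\<close> maps\<close>

text \<open>On an open set the derivative at a point sees only nearby values, so agreement on
  \<open>S\<close> passes to \<open>frechet_derivative\<close> and the induction closes.\<close>

lemma Ck_on_cong:
  assumes "open S" "\<And>x. x \<in> S \<Longrightarrow> f x = g x" "Ck_on k S f"
  shows "Ck_on k S g"
  using assms(2,3)
proof (induction k arbitrary: f g)
  case 0
  then show ?case by (simp cong: continuous_on_cong)
next
  case (Suc k)
  have *: "(g has_derivative frechet_derivative f (at x)) (at x)" if "x \<in> S" for x
  proof -
    have "f differentiable (at x)" using Suc.prems(2) that by simp
    then have "(f has_derivative frechet_derivative f (at x)) (at x)"
      by (simp add: frechet_derivative_works)
    from has_derivative_transform_within_open[OF this \<open>open S\<close> that] show ?thesis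
      using Suc.prems(1) by blast
  qed
  have eq: "frechet_derivative f (at x) = frechet_derivative g (at x)" if "x \<in> S" for x
    by (rule frechet_derivative_at[OF *[OF that]])
  have "Ck_on k S (\<lambda>x. frechet_derivative g (at x) v)" for v
    by (rule Suc.IH[of "\<lambda>x. frechet_derivative f (at x) v"]) (use Suc.prems(2) in \<open>simp_all add: eq\<close>)
  with * show ?case by (auto simp: differentiable_def)
qed

lemma Ck_on_subset: "Ck_on k S f \<Longrightarrow> T \<subseteq> S \<Longrightarrow> Ck_on k T f"
  by (induction k arbitrary: f) (auto intro: continuous_on_subset)

lemma Ck_on_const [simp]: "Ck_on k S (\<lambda>x. c)"
  by (induction k arbitrary: c) auto

text \<open>Uniqueness of derivatives lets an explicitly computed family \<open>f'\<close> stand in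
  for the chosen \<open>frechet_derivative\<close>.\<close>

lemma Ck_on_SucI:
  assumes "open S" "\<And>x. x \<in> S \<Longrightarrow> (f has_derivative f' x) (at x)"
    "\<And>v. Ck_on k S (\<lambda>x. f' x v)"
  shows "Ck_on (Suc k) S f"
proof -
  have "Ck_on k S (\<lambda>x. frechet_derivative f (at x) v)" for v
    by (rule Ck_on_cong[OF assms(1) _ assms(3)]) (simp add: frechet_derivative_at[OF assms(2), symmetric])
  then show ?thesis using assms(2) by (auto simp: differentiable_def)
qed

lemma Ck_on_Suc_has_derivative:
  assumes "Ck_on (Suc k) S f" "x \<in> S"
  shows "(f has_derivative frechet_derivative f (at x)) (at x)"
  using assms by (simp add: frechet_derivative_works)

lemma Ck_on_SucD: "Ck_on (Suc k) S f \<Longrightarrow> Ck_on k S f"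
proof (induction k arbitrary: f)
  case 0
  then show ?case
    by (auto intro!: continuous_at_imp_continuous_on differentiable_imp_continuous_within)
next
  case (Suc k)
  then show ?case by (metis Ck_on.simps(2))
qed

lemma Ck_on_bounded_linear_compose:
  assumes "bounded_linear h" "open S" "Ck_on k S f"
  shows "Ck_on k S (\<lambda>x. h (f x))"
  using assms(3)
proof (induction k arbitrary: f)
  case 0
  then show ?case
    by (simp add: bounded_linear.continuous_on[OF assms(1)])
next
  case (Suc k)
  show ?case
  proof (rule Ck_on_SucI[OF \<open>open S\<close>])
    show "((\<lambda>x. h (f x)) has_derivative (\<lambda>v. h (frechet_derivative f (at x) v))) (at x)"
      if "x \<in> S" for x
      by (rule bounded_linear.has_derivative[OF assms(1) Ck_on_Suc_has_derivative[OF Suc.prems that]])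
    show "Ck_on k S (\<lambda>x. h (frechet_derivative f (at x) v))" for v
      using Suc by auto
  qed
qed

lemma Ck_on_bounded_linear:
  assumes "bounded_linear h" "open S"
  shows "Ck_on k S h"
proof -
  have "Ck_on k S (\<lambda>x::'a. x)"
  proof (cases k)
    case (Suc m)
    show ?thesis
      unfolding Suc by (rule Ck_on_SucI[OF \<open>open S\<close> has_derivative_ident Ck_on_const])
  qed simp
  from Ck_on_bounded_linear_compose[OF assms this] show ?thesis .
qed

lemma Ck_on_add:
  assumes "open S" "Ck_on k S f" "Ck_on k S g"
  shows "Ck_on k S (\<lambda>x. f x + g x)"
  using assms(2,3)
proof (induction k arbitrary: f g)
  case (Suc k)
  show ?case
    by (rule Ck_on_SucI[OF \<open>open S\<close> has_derivative_add[OF Ck_on_Suc_has_derivative[OF Suc.prems(1)]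
          Ck_on_Suc_has_derivative[OF Suc.prems(2)]]]) (use Suc in auto)
qed (simp add: continuous_on_add)

lemma Ck_on_sum:
  assumes "open S" "\<And>i. i \<in> I \<Longrightarrow> Ck_on k S (f i)"
  shows "Ck_on k S (\<lambda>x. \<Sum>i\<in>I. f i x)"
  using assms(2) by (induction I rule: infinite_finite_induct) (auto intro: Ck_on_add[OF \<open>open S\<close>])

lemma Ck_on_bilinear:
  assumes "bounded_bilinear h" "open S" "Ck_on k S f" "Ck_on k S g"
  shows "Ck_on k S (\<lambda>x. h (f x) (g x))"
  using assms(3,4)
proof (induction k arbitrary: f g)
  case 0
  then show ?case by (simp add: bounded_bilinear.continuous_on[OF assms(1)])
next
  case (Suc k)
  show ?case
  proof (rule Ck_on_SucI[OF \<open>open S\<close>])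
    show "((\<lambda>x. h (f x) (g x)) has_derivative
        (\<lambda>v. h (f x) (frechet_derivative g (at x) v) + h (frechet_derivative f (at x) v) (g x))) (at x)"
      if "x \<in> S" for x
      by (rule bounded_bilinear.FDERIV[OF assms(1)
          Ck_on_Suc_has_derivative[OF Suc.prems(1) that] Ck_on_Suc_has_derivative[OF Suc.prems(2) that]])
    \<comment> \<open>The product rule leaves undifferentiated factors of class
      \<open>Suc k\<close>; \<open>Ck_on_SucD\<close> lowers them to class \<open>k\<close>, and the
      induction varies both factors.\<close>
    show "Ck_on k S (\<lambda>x. h (f x) (frechet_derivative g (at x) v) + h (frechet_derivative f (at x) v) (g x))" for v
      by (intro Ck_on_add[OF \<open>open S\<close>] Suc.IH Ck_on_SucD[OF Suc.prems(1)] Ck_on_SucD[OF Suc.prems(2)])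
         (use Suc.prems in auto)
  qed
qed

lemma Ck_on_prod:
  fixes f :: "'i \<Rightarrow> 'a::euclidean_space \<Rightarrow> 'b::{real_normed_algebra_1,comm_ring_1}"
  assumes "open S" "\<And>i. i \<in> I \<Longrightarrow> Ck_on k S (f i)"
  shows "Ck_on k S (\<lambda>x. \<Prod>i\<in>I. f i x)"
  using assms(2)
  by (induction I rule: infinite_finite_induct)
     (simp_all add: Ck_on_bilinear[OF bounded_bilinear_mult \<open>open S\<close>])

text \<open>In the chain rule the direction \<open>?g' x v\<close> moves with \<open>x\<close>,
  while \<open>Ck_on\<close> controls derivatives of \<open>f\<close> in fixed directions only.
  Expanding the direction in a basis leaves products to which the induction applies.\<close>

lemma Ck_on_compose:
  fixes f :: "'b::euclidean_space \<Rightarrow> 'c::real_normed_vector"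
    and g :: "'a::euclidean_space \<Rightarrow> 'b"
  assumes "open S" "open T" "g ` S \<subseteq> T" "Ck_on k T f" "Ck_on k S g"
  shows "Ck_on k S (\<lambda>x. f (g x))"
  using assms(4,5)
proof (induction k arbitrary: f)
  case 0
  then show ?case using assms(3) by (auto intro: continuous_on_compose2)
next
  case (Suc k)
  let ?f' = "\<lambda>y. frechet_derivative f (at y)"
  let ?g' = "\<lambda>x. frechet_derivative g (at x)"
  have f': "(f has_derivative ?f' (g x)) (at (g x))" if "x \<in> S" for x
    using Ck_on_Suc_has_derivative[OF Suc.prems(1)] assms(3) that by blast
  have "((\<lambda>x. f (g x)) has_derivative (\<lambda>v. \<Sum>b\<in>Basis. (?g' x v \<bullet> b) *\<^sub>R ?f' (g x) b)) (at x)"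
    if "x \<in> S" for x
  proof -
    have "linear (?f' (g x))"
      using f'[OF that] has_derivative_linear by blast
    then have "?f' (g x) y = (\<Sum>b\<in>Basis. (y \<bullet> b) *\<^sub>R ?f' (g x) b)" for y
      using linear_sum[of "?f' (g x)" "\<lambda>b. (y \<bullet> b) *\<^sub>R b" Basis]
      by (simp add: euclidean_representation linear_scale)
    then have eq: "(\<lambda>v. ?f' (g x) (?g' x v)) = (\<lambda>v. \<Sum>b\<in>Basis. (?g' x v \<bullet> b) *\<^sub>R ?f' (g x) b)"
      by blast
    show ?thesis
      using has_derivative_compose[OF Ck_on_Suc_has_derivative[OF Suc.prems(2) that] f'[OF that]]
      by (simp add: eq)
  qed
  moreover have "Ck_on k S (\<lambda>x. \<Sum>b\<in>Basis. (?g' x v \<bullet> b) *\<^sub>R ?f' (g x) b)" for v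
  proof (intro Ck_on_sum Ck_on_bilinear[OF bounded_bilinear_scaleR] \<open>open S\<close>)
    fix b :: 'b
    show "Ck_on k S (\<lambda>x. ?g' x v \<bullet> b)"
      using Suc.prems(2) by (intro Ck_on_bounded_linear_compose[OF bounded_linear_inner_left \<open>open S\<close>]) auto
    show "Ck_on k S (\<lambda>x. ?f' (g x) b)"
      by (rule Suc.IH[OF _ Ck_on_SucD[OF Suc.prems(2)]]) (use Suc.prems in auto)
  qed
  ultimately show ?case by (rule Ck_on_SucI[OF \<open>open S\<close>])
qed

lemma Ck_on_inverse:
  fixes f :: "'a::euclidean_space \<Rightarrow> 'b::real_normed_div_algebra"
  assumes "open S" "Ck_on k S f" "\<And>x. x \<in> S \<Longrightarrow> f x \<noteq> 0"
  shows "Ck_on k S (\<lambda>x. inverse (f x))"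
  using assms(2)
proof (induction k)
  case 0
  then show ?case using assms(3) by (auto intro: continuous_on_inverse)
next
  case (Suc k)
  \<comment> \<open>The derivative of the reciprocal contains the reciprocal itself, whose class
    \<open>k\<close> comes from the induction hypothesis.\<close>
  have IH: "Ck_on k S (\<lambda>x. inverse (f x))" using Suc Ck_on_SucD by blast
  have "Ck_on k S (\<lambda>x. - (inverse (f x) * frechet_derivative f (at x) v * inverse (f x)))" for v
    using IH Suc.prems
    by (intro Ck_on_bounded_linear_compose[OF bounded_linear_minus[OF bounded_linear_ident]]
        Ck_on_bilinear[OF bounded_bilinear_mult] \<open>open S\<close>) auto
  then show ?case
    using Ck_on_SucI[OF \<open>open S\<close> Deriv.has_derivative_inverse[OF assms(3) Ck_on_Suc_has_derivative[OF Suc.prems]]]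
    by blast
qed

lemma Ck_on_Pair:
  assumes "open S" "Ck_on k S f" "Ck_on k S g"
  shows "Ck_on k S (\<lambda>x. (f x, g x))"
proof -
  have "Ck_on k S (\<lambda>x. (f x, 0) + (0, g x))"
    by (intro Ck_on_add assms Ck_on_bounded_linear_compose[OF _ _ assms(2)]
        Ck_on_bounded_linear_compose[OF _ _ assms(3)] bounded_linear_Pair
        bounded_linear_ident bounded_linear_zero)
  then show ?thesis by simp
qed

text \<open>Differentiation under the integral sign: the derivative in direction \<open>v\<close> is
  an integral of the same shape, with the derivative of \<open>f\<close> in direction
  \<open>(v, 0)\<close> as integrand.\<close>

lemma Ck_on_integral:
  fixes f :: "'a::euclidean_space \<times> real \<Rightarrow> 'b::euclidean_space"
  assumes "open S" "Ck_on k (S \<times> UNIV) f"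
  shows "Ck_on k S (\<lambda>x. integral {0..1} (\<lambda>s. f (x, s)))"
  using assms(2)
proof (induction k arbitrary: f)
  case 0
  then have "continuous_on (S \<times> cbox 0 1) (\<lambda>(x, s). f (x, s))"
    by (auto intro: continuous_on_subset)
  from integral_continuous_on_param[OF this] show ?case by simp
next
  case (Suc k)
  let ?f' = "\<lambda>p. frechet_derivative f (at p)"
  have der: "(f has_derivative ?f' (x, s)) (at (x, s))" if "x \<in> S" for x s
    using Ck_on_Suc_has_derivative[OF Suc.prems] that by auto
  have cont: "continuous_on (S \<times> UNIV) (\<lambda>p. ?f' p v)" for v
  proof -
    have "Ck_on k (S \<times> UNIV) (\<lambda>p. ?f' p v)" using Suc.prems by (simp del: split_paired_All)
    then have "Ck_on 0 (S \<times> UNIV) (\<lambda>p. ?f' p v)" by (induction k) (blast dest: Ck_on_SucD)+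
    then show ?thesis by simp
  qed
  \<comment> \<open>The Leibniz rule wants the parameter derivative as a continuous map into bounded
    operators; in finite dimension, continuity in each fixed direction is enough for that.\<close>
  define F where "F x s = Blinfun (\<lambda>v. ?f' (x, s) (v, 0))" for x s
  have F: "blinfun_apply (F x s) v = ?f' (x, s) (v, 0)" if "x \<in> S" for x s v
  proof -
    have "bounded_linear (\<lambda>v. ?f' (x, s) (v, 0))"
      by (intro bounded_linear_compose[OF has_derivative_bounded_linear[OF der[OF that]]]
          bounded_linear_Pair bounded_linear_ident bounded_linear_zero)
    then show ?thesis by (simp add: F_def bounded_linear_Blinfun_apply)
  qed
  have contF: "continuous_on (S \<times> UNIV) (\<lambda>(x, s). F x s)"
  proof (rule continuous_on_blinfun_componentwise)
    show "continuous_on (S \<times> UNIV) (\<lambda>p. blinfun_apply (case p of (x, s) \<Rightarrow> F x s) i)" for i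
      using cont[of "(i, 0)"] by (rule continuous_on_eq) (auto simp: F)
  qed
  show ?case
  proof (rule Ck_on_SucI[OF \<open>open S\<close>])
    fix x assume x: "x \<in> S"
    \<comment> \<open>The Leibniz rule is applied on a convex set, hence on a ball inside
      \<open>S\<close>.\<close>
    obtain e where e: "e > 0" "ball x e \<subseteq> S" using \<open>open S\<close> x openE by blast
    have derF: "((\<lambda>x. f (x, s)) has_derivative blinfun_apply (F y s)) (at y)" if "y \<in> S" for y s
    proof -
      have "((\<lambda>x. f (x, s)) has_derivative (\<lambda>v. ?f' (y, s) (v, 0))) (at y)"
        by (rule has_derivative_compose[of "\<lambda>x. (x, s)" "\<lambda>v. (v, 0)", OF _ der[OF that]])
           (auto intro!: derivative_eq_intros)
      then show ?thesis by (rule has_derivative_eq_rhs) (simp add: F that fun_eq_iff)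
    qed
    have contf: "continuous_on (S \<times> UNIV) f"
      using der by (auto intro!: continuous_at_imp_continuous_on has_derivative_continuous)
    have "((\<lambda>x. integral (cbox 0 1) (\<lambda>s. f (x, s))) has_derivative integral (cbox 0 1) (F x))
        (at x within ball x e)"
    proof (rule leibniz_rule)
      show "((\<lambda>y. f (y, s)) has_derivative blinfun_apply (F y s)) (at y within ball x e)"
        if "y \<in> ball x e" for y s
        using derF e that by (blast intro: has_derivative_at_withinI)
      show "(\<lambda>s. f (y, s)) integrable_on cbox 0 1" if "y \<in> ball x e" for y
        using that e by (intro integrable_continuous continuous_on_compose2[OF contf]) (auto intro!: continuous_intros)
      show "continuous_on (ball x e \<times> cbox 0 1) (\<lambda>(y, s). F y s)"
        using contF e by (auto intro: continuous_on_subset)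
    qed (use e in auto)
    then have "((\<lambda>x. integral {0..1} (\<lambda>s. f (x, s))) has_derivative integral {0..1} (F x)) (at x)"
      using e by (simp add: at_within_open[OF _ open_ball])
    moreover have "blinfun_apply (integral {0..1} (F x)) v = integral {0..1} (\<lambda>s. ?f' (x, s) (v, 0))" for v
    proof -
      have "F x integrable_on {0..1}"
        using x by (intro integrable_continuous_interval continuous_on_compose2[OF contF, of _ "\<lambda>s. (x, s)", simplified])
          (auto intro!: continuous_intros)
      from integral_linear[OF this blinfun.bounded_linear_left, of v] show ?thesis
        by (simp add: o_def F[OF x])
    qed
    ultimately show "((\<lambda>x. integral {0..1} (\<lambda>s. f (x, s))) has_derivative
        (\<lambda>v. integral {0..1} (\<lambda>s. ?f' (x, s) (v, 0)))) (at x)"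
      by (rule_tac has_derivative_eq_rhs) (auto simp: fun_eq_iff)
  next
    show "Ck_on k S (\<lambda>x. integral {0..1} (\<lambda>s. ?f' (x, s) (v, 0)))" for v
      using Suc.IH[of "\<lambda>p. ?f' p (v, 0)"] Suc.prems by auto
  qed
qed

subsection \<open>Matrices\<close>

lemma matrix_add_rdistrib: "(A + B) ** C = A ** C + B ** (C :: 'a::semiring_1^'n^'m)"
  by (simp add: matrix_matrix_mult_def vec_eq_iff distrib_right sum.distrib)

lemma matrix_diff_ldistrib: "A ** (B - C) = A ** B - A ** (C :: 'a::ring_1^'n^'m)"
  by (simp add: matrix_matrix_mult_def vec_eq_iff right_diff_distrib sum_subtractf)

lemma matrix_diff_rdistrib: "(A - B) ** C = A ** C - B ** (C :: 'a::ring_1^'n^'m)"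
  by (simp add: matrix_matrix_mult_def vec_eq_iff left_diff_distrib sum_subtractf)

lemma matrix_minus_left: "(- A) ** B = - (A ** (B :: 'a::ring_1^'n^'m))"
  by (simp add: matrix_matrix_mult_def vec_eq_iff sum_negf)

lemma matrix_minus_right: "A ** (- B) = - (A ** (B :: 'a::ring_1^'n^'m))"
  by (simp add: matrix_matrix_mult_def vec_eq_iff sum_negf)

lemma cscale_nth [simp]: "(c *\<^sub>m A) $ i $ k = c * A $ i $ k"
  by (simp add: cscale_def)

lemma cscale_mult_left: "(c *\<^sub>m A) ** B = c *\<^sub>m (A ** B)"
  by (simp add: matrix_matrix_mult_def vec_eq_iff sum_distrib_left mult_ac)

lemma cscale_mult_right: "A ** (c *\<^sub>m B) = c *\<^sub>m (A ** B)"
  by (simp add: matrix_matrix_mult_def vec_eq_iff sum_distrib_left mult_ac)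

lemma cscale_add_right: "c *\<^sub>m (A + B) = c *\<^sub>m A + c *\<^sub>m B"
  by (simp add: vec_eq_iff distrib_left)

lemma cscale_diff_right: "c *\<^sub>m (A - B) = c *\<^sub>m A - c *\<^sub>m B"
  by (simp add: vec_eq_iff right_diff_distrib)

lemma cscale_add_left: "(c + d) *\<^sub>m A = c *\<^sub>m A + d *\<^sub>m A"
  by (simp add: vec_eq_iff distrib_right)

lemma cscale_cscale: "c *\<^sub>m (d *\<^sub>m A) = (c * d) *\<^sub>m A"
  by (simp add: vec_eq_iff)

lemma cscale_one [simp]: "1 *\<^sub>m A = A"
  by (simp add: vec_eq_iff)

lemma cscale_zero [simp]: "0 *\<^sub>m A = 0" "c *\<^sub>m 0 = 0"
  by (simp_all add: vec_eq_iff)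

lemmas matrix_expand = matrix_mul_assoc matrix_add_ldistrib matrix_add_rdistrib
  matrix_diff_ldistrib matrix_diff_rdistrib matrix_minus_left matrix_minus_right
  cscale_mult_left cscale_mult_right cscale_add_right cscale_diff_right
  cscale_cscale commutator_def

lemma matrix_inv_right: "invertible A \<Longrightarrow> A ** matrix_inv A = mat 1"
  and matrix_inv_left: "invertible A \<Longrightarrow> matrix_inv A ** A = mat 1"
  unfolding invertible_def matrix_inv_def by (metis (mono_tags, lifting) someI_ex)+

lemma matrix_inv_unique:
  assumes "A ** B = mat 1" "B ** A = mat 1"
  shows "matrix_inv A = B"
proof -
  have "invertible A" using assms by (auto simp: invertible_def)
  then have "matrix_inv A ** (A ** B) = B"
    by (simp add: matrix_mul_assoc matrix_inv_left)
  then show ?thesis by (simp add: assms)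
qed

lemma matrix_inv_mult:
  "invertible A \<Longrightarrow> invertible B \<Longrightarrow> matrix_inv (A ** B) = matrix_inv B ** matrix_inv A"
  by (rule matrix_inv_unique) (metis matrix_inv_left matrix_inv_right matrix_mul_assoc matrix_mul_rid)+

lemma matrix_mul_eq_iff:
  "invertible A \<Longrightarrow> matrix_inv A ** B = C \<longleftrightarrow> B = A ** C"
  by (metis matrix_inv_left matrix_inv_right matrix_mul_assoc matrix_mul_lid)

lemma invertible_matrix_inv: "invertible A \<Longrightarrow> invertible (matrix_inv A)"
  by (metis invertible_def matrix_inv_left matrix_inv_right)

lemma trace_commutator: "trace (commutator A B) = 0"
  by (simp add: commutator_def trace_sub trace_mul_sym[of A B])

text \<open>Cyclicity of the trace. It is used to see that commutators with \<open>a\<close> are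
  orthogonal to the centralizer of \<open>a\<close>.\<close>

lemma trace_mult_commutator: "trace (z ** commutator a y) = trace (commutator z a ** y)"
proof -
  have "trace (z ** (y ** a)) = trace (a ** z ** y)"
    using trace_mul_sym[of "z ** y" a] by (simp only: matrix_mul_assoc)
  then show ?thesis
    by (simp add: commutator_def matrix_diff_ldistrib matrix_diff_rdistrib trace_sub matrix_mul_assoc)
qed

lemma bounded_bilinear_matrix_mult:
  "bounded_bilinear ((**) :: complex^'n^'n \<Rightarrow> complex^'n^'n \<Rightarrow> complex^'n^'n)"
  unfolding bilinear_conv_bounded_bilinear[symmetric] bilinear_def
  by (auto intro!: linearI simp: matrix_add_ldistrib matrix_add_rdistrib)
     (simp_all add: matrix_matrix_mult_def vec_eq_iff scaleR_sum_right)

lemma bounded_bilinear_cscale: "bounded_bilinear ((*\<^sub>m) :: complex \<Rightarrow> complex^'n^'n \<Rightarrow> complex^'n^'n)"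
  unfolding bilinear_conv_bounded_bilinear[symmetric] bilinear_def
  by (auto intro!: linearI simp: cscale_add_left cscale_add_right vec_eq_iff)

section \<open>Smoothness of matrix-valued maps\<close>

lemma Ck_on_vec_nth: "open S \<Longrightarrow> Ck_on k S f \<Longrightarrow> Ck_on k S (\<lambda>x. f x $ i)"
  by (rule Ck_on_bounded_linear_compose[OF bounded_linear_vec_nth])

lemma Ck_on_vec:
  fixes f :: "'a::euclidean_space \<Rightarrow> 'b::euclidean_space^'n"
  assumes "open S" "\<And>i. Ck_on k S (\<lambda>x. f x $ i)"
  shows "Ck_on k S f"
proof -
  have "bounded_linear (axis i :: 'b \<Rightarrow> 'b^'n)" for i
    unfolding linear_conv_bounded_linear[symmetric] by (intro linearI) (auto simp: vec_eq_iff axis_def)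
  from Ck_on_bounded_linear_compose[OF this assms]
  have "Ck_on k S (\<lambda>x. \<Sum>i\<in>UNIV. axis i (f x $ i))"
    by (intro Ck_on_sum[OF assms(1)])
  moreover have "(\<Sum>i\<in>UNIV. axis i (y $ i)) = y" for y :: "'b^'n"
    by (simp add: vec_eq_iff axis_def)
  ultimately show ?thesis by simp
qed

lemma Ck_on_matrix:
  fixes f :: "'a::euclidean_space \<Rightarrow> complex^'n^'m"
  shows "open S \<Longrightarrow> (\<And>i j. Ck_on k S (\<lambda>x. f x $ i $ j)) \<Longrightarrow> Ck_on k S f"
  by (intro Ck_on_vec)

lemma Ck_on_det:
  fixes f :: "'a::euclidean_space \<Rightarrow> complex^'n^'n"
  assumes "open S" "Ck_on k S f"
  shows "Ck_on k S (\<lambda>x. det (f x))"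
  unfolding det_def
  by (intro Ck_on_sum Ck_on_bilinear[OF bounded_bilinear_mult] Ck_on_prod Ck_on_const Ck_on_vec_nth assms)

text \<open>Cramer's rule for the columns of the inverse. It reduces smoothness of the inverse to
  that of determinants and of one scalar reciprocal.\<close>

lemma matrix_inv_nth:
  fixes A :: "complex^'n^'n"
  assumes "invertible A"
  shows "matrix_inv A $ i $ k = det (\<chi> i' j. if j = i then axis k 1 $ i' else A $ i' $ j) * inverse (det A)"
proof -
  have "det A \<noteq> 0" using assms by (simp add: invertible_det_nz)
  moreover have "A *v (matrix_inv A *v axis k 1) = axis k 1"
    by (simp add: matrix_vector_mul_assoc matrix_inv_right assms)
  ultimately have "matrix_inv A *v axis k 1 =
      (\<chi> i. det (\<chi> i' j. if j = i then axis k 1 $ i' else A $ i' $ j) / det A)"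
    by (simp add: cramer)
  moreover have "(matrix_inv A *v axis k 1) $ i = matrix_inv A $ i $ k"
    by (simp add: matrix_vector_mult_def axis_def if_distrib cong: if_cong)
  ultimately show ?thesis by (simp add: divide_inverse)
qed

lemma Ck_on_matrix_inv:
  fixes f :: "'a::euclidean_space \<Rightarrow> complex^'n^'n"
  assumes "open S" "Ck_on k S f" "\<And>x. x \<in> S \<Longrightarrow> invertible (f x)"
  shows "Ck_on k S (\<lambda>x. matrix_inv (f x))"
proof (rule Ck_on_matrix[OF assms(1)])
  fix i j
  have "Ck_on k S (\<lambda>x. det (\<chi> i' j'. if j' = i then axis j 1 $ i' else f x $ i' $ j'))"
  proof (intro Ck_on_det Ck_on_matrix assms(1))
    show "Ck_on k S (\<lambda>x. (\<chi> i' j'. if j' = i then axis j 1 $ i' else f x $ i' $ j') $ i' $ j')" for i' j'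
      by (cases "j' = i") (simp_all add: Ck_on_vec_nth assms)
  qed
  moreover have "Ck_on k S (\<lambda>x. inverse (det (f x)))"
    by (rule Ck_on_inverse[OF assms(1) Ck_on_det[OF assms(1,2)]]) (use assms(3) in \<open>simp add: invertible_det_nz\<close>)
  ultimately have "Ck_on k S (\<lambda>x. det (\<chi> i' j'. if j' = i then axis j 1 $ i' else f x $ i' $ j') * inverse (det (f x)))"
    by (rule Ck_on_bilinear[OF bounded_bilinear_mult assms(1)])
  then show "Ck_on k S (\<lambda>x. matrix_inv (f x) $ i $ j)"
    by (rule Ck_on_cong[OF assms(1), rotated]) (simp add: matrix_inv_nth assms(3))
qed

lemma smooth_on_Ck: "smooth_on S f \<Longrightarrow> Ck_on k S f"
  by (simp add: smooth_on_def)

lemma smooth_on_cong: "open S \<Longrightarrow> (\<And>x. x \<in> S \<Longrightarrow> f x = g x) \<Longrightarrow> smooth_on S f \<Longrightarrow> smooth_on S g"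
  unfolding smooth_on_def by (meson Ck_on_cong)

lemma smooth_on_subset: "smooth_on S f \<Longrightarrow> T \<subseteq> S \<Longrightarrow> smooth_on T f"
  unfolding smooth_on_def by (meson Ck_on_subset)

lemma smooth_on_const: "smooth_on S (\<lambda>x. c)"
  by (simp add: smooth_on_def)

lemma smooth_on_bounded_linear: "bounded_linear h \<Longrightarrow> open S \<Longrightarrow> smooth_on S h"
  by (simp add: smooth_on_def Ck_on_bounded_linear)

lemma smooth_on_add: "open S \<Longrightarrow> smooth_on S f \<Longrightarrow> smooth_on S g \<Longrightarrow> smooth_on S (\<lambda>x. f x + g x)"
  by (simp add: smooth_on_def Ck_on_add)

lemma smooth_on_minus: "open S \<Longrightarrow> smooth_on S f \<Longrightarrow> smooth_on S (\<lambda>x. - f x)"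
  unfolding smooth_on_def
  by (blast intro: Ck_on_bounded_linear_compose[OF bounded_linear_minus[OF bounded_linear_ident]])

lemma smooth_on_diff: "open S \<Longrightarrow> smooth_on S f \<Longrightarrow> smooth_on S g \<Longrightarrow> smooth_on S (\<lambda>x. f x - g x)"
  using smooth_on_add[OF _ _ smooth_on_minus] by simp

lemma smooth_on_bilinear:
  "bounded_bilinear h \<Longrightarrow> open S \<Longrightarrow> smooth_on S f \<Longrightarrow> smooth_on S g \<Longrightarrow> smooth_on S (\<lambda>x. h (f x) (g x))"
  by (simp add: smooth_on_def Ck_on_bilinear)

lemmas smooth_on_mult = smooth_on_bilinear[OF bounded_bilinear_matrix_mult]
lemmas smooth_on_cscale = smooth_on_bilinear[OF bounded_bilinear_cscale]

lemma smooth_on_commutator: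
  "open S \<Longrightarrow> smooth_on S f \<Longrightarrow> smooth_on S g \<Longrightarrow> smooth_on S (\<lambda>x. commutator (f x) (g x))"
  unfolding commutator_def by (intro smooth_on_diff smooth_on_mult)

lemma smooth_on_compose:
  fixes f :: "'b::euclidean_space \<Rightarrow> 'c::real_normed_vector" and g :: "'a::euclidean_space \<Rightarrow> 'b"
  shows "open S \<Longrightarrow> open T \<Longrightarrow> g ` S \<subseteq> T \<Longrightarrow> smooth_on T f \<Longrightarrow> smooth_on S g \<Longrightarrow> smooth_on S (\<lambda>x. f (g x))"
  unfolding smooth_on_def by (blast intro: Ck_on_compose)

lemma smooth_on_Pair: "open S \<Longrightarrow> smooth_on S f \<Longrightarrow> smooth_on S g \<Longrightarrow> smooth_on S (\<lambda>x. (f x, g x))"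
  by (simp add: smooth_on_def Ck_on_Pair)

lemma smooth_on_continuous: "smooth_on S f \<Longrightarrow> continuous_on S f"
  using smooth_on_Ck[of S f 0] by simp

subsection \<open>Divided differences\<close>

definition divided_difference :: "complex \<Rightarrow> (complex \<Rightarrow> complex) \<Rightarrow> complex \<Rightarrow> complex"
  where "divided_difference \<alpha> f l = (if l = \<alpha> then deriv f \<alpha> else (f l - f \<alpha>) / (l - \<alpha>))"

lemma holomorphic_divided_difference:
  "f holomorphic_on UNIV \<Longrightarrow> divided_difference \<alpha> f holomorphic_on UNIV"
  using pole_lemma_open[of f UNIV \<alpha>] by (simp add: divided_difference_def[abs_def])

text \<open>The fundamental theorem of calculus along the segment from \<open>\<alpha>\<close> to
  \<open>l\<close>. The integral has no case distinction at \<open>\<alpha>\<close>, so joint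
  smoothness can be read off from it.\<close>

lemma divided_difference_integral:
  assumes "f holomorphic_on UNIV"
  shows "divided_difference \<alpha> f l = integral {0..1} (\<lambda>s. deriv f (\<alpha> + of_real s * (l - \<alpha>)))"
proof (cases "l = \<alpha>")
  case False
  have "((\<lambda>s. deriv f (\<alpha> + of_real s * (l - \<alpha>)) * (l - \<alpha>)) has_integral
      f (\<alpha> + of_real 1 * (l - \<alpha>)) - f (\<alpha> + of_real 0 * (l - \<alpha>))) {0..1}"
  proof (rule fundamental_theorem_of_calculus)
    fix s :: real assume "s \<in> {0..1}"
    have "(f has_field_derivative deriv f (\<alpha> + of_real s * (l - \<alpha>))) (at (\<alpha> + of_real s * (l - \<alpha>)))"
      using assms by (simp add: holomorphic_derivI)
    then have "((\<lambda>s. f (\<alpha> + of_real s * (l - \<alpha>))) has_vector_derivative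
        (l - \<alpha>) * deriv f (\<alpha> + of_real s * (l - \<alpha>))) (at s)"
      by (intro field_vector_diff_chain_at[unfolded o_def] has_vector_derivative_real_field)
         (auto intro!: derivative_eq_intros simp: has_vector_derivative_def scaleR_conv_of_real)
    then show "((\<lambda>s. f (\<alpha> + of_real s * (l - \<alpha>))) has_vector_derivative
        deriv f (\<alpha> + of_real s * (l - \<alpha>)) * (l - \<alpha>)) (at s within {0..1})"
      by (simp add: mult.commute has_vector_derivative_at_within)
  qed simp
  from has_integral_mult_left[OF this, of "inverse (l - \<alpha>)"]
  have "((\<lambda>s. deriv f (\<alpha> + of_real s * (l - \<alpha>))) has_integral (f l - f \<alpha>) / (l - \<alpha>)) {0..1}"
    using False by (simp add: divide_inverse mult.assoc)
  then show ?thesis using False by (simp add: divided_difference_def integral_unique)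
qed (simp add: divided_difference_def)

lemma smooth_on_divided_difference:
  fixes e :: "'a::euclidean_space \<Rightarrow> complex \<Rightarrow> complex"
  assumes "open U" and smooth: "smooth_on (U \<times> UNIV) (\<lambda>(p, l). e p l)"
    and hol: "\<And>p. p \<in> U \<Longrightarrow> e p holomorphic_on UNIV"
  shows "smooth_on (U \<times> UNIV) (\<lambda>(p, l). divided_difference \<alpha> (e p) l)"
proof -
  have UU: "open (U \<times> (UNIV :: complex set))" "open ((U \<times> (UNIV :: complex set)) \<times> (UNIV :: real set))"
    using assms by (simp_all add: open_Times)
  let ?e' = "\<lambda>q. frechet_derivative (\<lambda>(p, l). e p l) (at q) (0, 1)"
  \<comment> \<open>The real derivative of the holomorphic \<open>e p\<close> is multiplication by
    \<open>deriv (e p) l\<close>; evaluated at 1 it is the complex derivative, which thus inherits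
    joint smoothness.\<close>
  have deriv_eq: "?e' (p, l) = deriv (e p) l" if "p \<in> U" for p l
  proof -
    have "((\<lambda>(p, l). e p l) has_derivative frechet_derivative (\<lambda>(p, l). e p l) (at (p, l))) (at (p, l))"
      using Ck_on_Suc_has_derivative[OF smooth_on_Ck[OF smooth]] that by blast
    from has_derivative_compose[of "\<lambda>l. (p, l)" "\<lambda>v. (0, v)" l UNIV, OF _ this]
    have "((\<lambda>l. e p l) has_derivative (\<lambda>v. frechet_derivative (\<lambda>(p, l). e p l) (at (p, l)) (0, v))) (at l)"
      by (simp add: has_derivative_Pair)
    moreover have "(e p has_derivative (*) (deriv (e p) l)) (at l)"
      using hol[OF that] by (simp add: holomorphic_derivI flip: has_field_derivative_def)
    ultimately have "(\<lambda>v. frechet_derivative (\<lambda>(p, l). e p l) (at (p, l)) (0, v)) = (*) (deriv (e p) l)"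
      by (rule has_derivative_unique)
    from fun_cong[OF this, of 1] show ?thesis by simp
  qed
  have smooth': "smooth_on (U \<times> UNIV) ?e'"
    unfolding smooth_on_def using smooth_on_Ck[OF smooth] Ck_on.simps(2) by blast
  let ?h = "\<lambda>q::('a \<times> complex) \<times> real. (fst (fst q), \<alpha> + snd q *\<^sub>R (snd (fst q) - \<alpha>))"
  have bl: "bounded_linear (\<lambda>q::('a \<times> complex) \<times> real. fst (fst q))"
    "bounded_linear (\<lambda>q::('a \<times> complex) \<times> real. snd (fst q))"
    "bounded_linear (\<lambda>q::('a \<times> complex) \<times> real. snd q)"
    by (intro bounded_linear_fst_comp bounded_linear_snd_comp bounded_linear_fst bounded_linear_snd)+
  have "smooth_on ((U \<times> UNIV) \<times> UNIV) ?h"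
    by (rule smooth_on_Pair[OF UU(2) smooth_on_bounded_linear[OF bl(1) UU(2)]
        smooth_on_add[OF UU(2) smooth_on_const smooth_on_bilinear[OF bounded_bilinear_scaleR UU(2)
        smooth_on_bounded_linear[OF bl(3) UU(2)]
        smooth_on_diff[OF UU(2) smooth_on_bounded_linear[OF bl(2) UU(2)] smooth_on_const]]]])
  then have "smooth_on ((U \<times> UNIV) \<times> UNIV) (\<lambda>q. ?e' (?h q))"
    by (intro smooth_on_compose[OF UU(2,1) _ smooth']) auto
  then have "smooth_on (U \<times> UNIV) (\<lambda>x. integral {0..1} (\<lambda>s. ?e' (?h (x, s))))"
    unfolding smooth_on_def using Ck_on_integral[OF UU(1)] by blast
  then show ?thesis
    by (rule smooth_on_cong[OF UU(1), rotated])
       (auto simp: deriv_eq divided_difference_integral[OF hol] scaleR_conv_of_real)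
qed

subsection \<open>Partial derivatives\<close>

text \<open>Total differentiability is part of the notion, so product rules and uniqueness come from
  the full derivative; \<open>dx\<close> and \<open>dt\<close> are recovered for the two unit
  vectors. The free direction \<open>v\<close> lets both equations of the trivialization share one
  computation.\<close>

definition has_partial_derivative ::
    "'a::real_normed_vector \<Rightarrow> ('a \<Rightarrow> 'b::real_normed_vector) \<Rightarrow> 'b \<Rightarrow> 'a \<Rightarrow> bool"
  where "has_partial_derivative v f D p \<longleftrightarrow> (\<exists>f'. (f has_derivative f') (at p) \<and> f' v = D)"

lemma has_partial_derivative_unique:
  "has_partial_derivative v f D p \<Longrightarrow> has_partial_derivative v f D' p \<Longrightarrow> D = D'"
  unfolding has_partial_derivative_def using has_derivative_unique by blast

lemma has_partial_derivative_const: "has_partial_derivative v (\<lambda>_. c) 0 p"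
  unfolding has_partial_derivative_def by (intro exI[of _ "\<lambda>_. 0"]) simp

lemma has_partial_derivative_add:
  "has_partial_derivative v f D p \<Longrightarrow> has_partial_derivative v g D' p \<Longrightarrow>
    has_partial_derivative v (\<lambda>q. f q + g q) (D + D') p"
  unfolding has_partial_derivative_def by (blast intro: has_derivative_add)

lemma has_partial_derivative_diff:
  "has_partial_derivative v f D p \<Longrightarrow> has_partial_derivative v g D' p \<Longrightarrow>
    has_partial_derivative v (\<lambda>q. f q - g q) (D - D') p"
  unfolding has_partial_derivative_def by (blast intro: has_derivative_diff)

lemma has_partial_derivative_mult:
  fixes f g :: "'a::real_normed_vector \<Rightarrow> complex^'n^'n"
  shows "has_partial_derivative v f D p \<Longrightarrow> has_partial_derivative v g D' p \<Longrightarrow>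
    has_partial_derivative v (\<lambda>q. f q ** g q) (f p ** D' + D ** g p) p"
  unfolding has_partial_derivative_def
  by (blast intro: bounded_bilinear.FDERIV[OF bounded_bilinear_matrix_mult])

lemma has_partial_derivative_cmult:
  fixes f :: "'a::real_normed_vector \<Rightarrow> complex^'n^'n" and c :: "complex^'n^'n"
  assumes "has_partial_derivative v f D p"
  shows "has_partial_derivative v (\<lambda>q. c ** f q) (c ** D) p"
  using has_partial_derivative_mult[OF has_partial_derivative_const[of v c] assms] by simp

lemma has_partial_derivative_cscale:
  fixes f :: "'a::real_normed_vector \<Rightarrow> complex^'n^'n"
  assumes "has_partial_derivative v f D p"
  shows "has_partial_derivative v (\<lambda>q. c *\<^sub>m f q) (c *\<^sub>m D) p"
  using has_partial_derivative_cmult[OF assms, of "c *\<^sub>m mat 1"] by (simp add: cscale_mult_left)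

lemma has_partial_derivative_cong:
  assumes "open S" "p \<in> S" "\<And>q. q \<in> S \<Longrightarrow> f q = g q" "has_partial_derivative v f D p"
  shows "has_partial_derivative v g D p"
  using assms unfolding has_partial_derivative_def
  by (blast intro: has_derivative_transform_within_open)

lemma smooth_on_has_partial_derivative:
  "smooth_on S f \<Longrightarrow> p \<in> S \<Longrightarrow> has_partial_derivative v f (frechet_derivative f (at p) v) p"
  unfolding has_partial_derivative_def
  using Ck_on_Suc_has_derivative[OF smooth_on_Ck] by blast

lemma dx_eq:
  assumes "has_partial_derivative (1, 0) f D p"
  shows "dx f p = D"
proof -
  obtain f' where f': "(f has_derivative f') (at (fst p, snd p))" "f' (1, 0) = D"
    using assms by (auto simp: has_partial_derivative_def)
  have "((\<lambda>s. f (s, snd p)) has_derivative (\<lambda>h. f' (h, 0))) (at (fst p))"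
    by (rule has_derivative_compose[of "\<lambda>s. (s, snd p)" "\<lambda>h. (h, 0)", OF _ f'(1)])
       (simp add: has_derivative_Pair)
  moreover have "f' (h, 0) = h *\<^sub>R D" for h
    using linear_scale[OF has_derivative_linear[OF f'(1)], of h "(1, 0)"] f'(2) by simp
  ultimately show ?thesis
    by (simp add: dx_def has_vector_derivative_def vector_derivative_at)
qed

lemma dt_eq:
  assumes "has_partial_derivative (0, 1) f D p"
  shows "dt f p = D"
proof -
  obtain f' where f': "(f has_derivative f') (at (fst p, snd p))" "f' (0, 1) = D"
    using assms by (auto simp: has_partial_derivative_def)
  have "((\<lambda>s. f (fst p, s)) has_derivative (\<lambda>h. f' (0, h))) (at (snd p))"
    by (rule has_derivative_compose[of "\<lambda>s. (fst p, s)" "\<lambda>h. (0, h)", OF _ f'(1)])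
       (simp add: has_derivative_Pair)
  moreover have "f' (0, h) = h *\<^sub>R D" for h
    using linear_scale[OF has_derivative_linear[OF f'(1)], of h "(0, 1)"] f'(2) by simp
  ultimately show ?thesis
    by (simp add: dt_def has_vector_derivative_def vector_derivative_at)
qed

lemma smooth_on_dx:
  assumes "smooth_on S f" "p \<in> S"
  shows "has_partial_derivative (1, 0) f (dx f p) p"
  using smooth_on_has_partial_derivative[OF assms] dx_eq by metis

lemma smooth_on_dt:
  assumes "smooth_on S f" "p \<in> S"
  shows "has_partial_derivative (0, 1) f (dt f p) p"
  using smooth_on_has_partial_derivative[OF assms] dt_eq by metis

section \<open>Removable singularities in the spectral parameter\<close>

lemma continuous_eq_removable:
  fixes f g :: "complex \<Rightarrow> 'b::t2_space"
  assumes "continuous_on UNIV f" "continuous_on UNIV g" "\<And>l. l \<noteq> \<alpha> \<Longrightarrow> f l = g l"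
  shows "f \<alpha> = g \<alpha>"
proof -
  have f: "(f \<longlongrightarrow> f \<alpha>) (at \<alpha>)" and g: "(g \<longlongrightarrow> g \<alpha>) (at \<alpha>)"
    using assms(1,2) by (auto simp: continuous_on_eq_continuous_at isCont_def)
  have "(f \<longlongrightarrow> g \<alpha>) (at \<alpha>)"
    by (rule Lim_transform_eventually[OF g]) (auto simp: eventually_at assms(3) intro: exI[of _ 1])
  from tendsto_unique[OF _ f this] show ?thesis by simp
qed

text \<open>By joint smoothness the derivative in \<open>p\<close> depends continuously on
  \<open>l\<close>, so its limit at \<open>\<alpha>\<close> is determined by the values
  elsewhere.\<close>

lemma has_partial_derivative_removable:
  fixes F :: "'a::euclidean_space \<Rightarrow> complex \<Rightarrow> 'b::real_normed_vector"
  assumes smooth: "smooth_on (U \<times> UNIV) (\<lambda>(p, l). F p l)" and p: "p \<in> U"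
    and G: "continuous_on UNIV G" "\<And>l. l \<noteq> \<alpha> \<Longrightarrow> has_partial_derivative v (\<lambda>q. F q l) (G l) p"
  shows "has_partial_derivative v (\<lambda>q. F q l) (G l) p"
proof -
  let ?F' = "\<lambda>l. frechet_derivative (\<lambda>(p, l). F p l) (at (p, l)) (v, 0)"
  have F': "has_partial_derivative v (\<lambda>q. F q l) (?F' l) p" for l
  proof -
    have "((\<lambda>(p, l). F p l) has_derivative frechet_derivative (\<lambda>(p, l). F p l) (at (p, l))) (at (p, l))"
      using Ck_on_Suc_has_derivative[OF smooth_on_Ck[OF smooth]] p by blast
    from has_derivative_compose[of "\<lambda>q. (q, l)" "\<lambda>v. (v, 0)" p UNIV, OF _ this] show ?thesis
      by (auto simp: has_partial_derivative_def has_derivative_Pair)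
  qed
  have "Ck_on 0 (U \<times> UNIV) (\<lambda>q. frechet_derivative (\<lambda>(p, l). F p l) (at q) (v, 0))"
    using smooth_on_Ck[OF smooth, of "Suc 0"] Ck_on.simps(2) by blast
  then have cont: "continuous_on (U \<times> UNIV) (\<lambda>q. frechet_derivative (\<lambda>(p, l). F p l) (at q) (v, 0))"
    by simp
  have "continuous_on UNIV ?F'"
    by (rule continuous_on_compose2[OF cont, of UNIV "\<lambda>l. (p, l)"]) (use p in \<open>auto intro!: continuous_intros\<close>)
  moreover have "?F' l = G l" if "l \<noteq> \<alpha>" for l
    using F' G(2)[OF that] by (rule has_partial_derivative_unique)
  ultimately have "?F' \<alpha> = G \<alpha>"
    using G(1) continuous_eq_removable by blast
  then have "?F' l = G l" for l
    using F' G(2) by (cases "l = \<alpha>") (auto intro: has_partial_derivative_unique)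
  with F'[of l] show ?thesis by simp
qed

section \<open>Divided differences of matrix families\<close>

definition matrix_divided_difference :: "complex \<Rightarrow> (complex \<Rightarrow> complex^'n^'n) \<Rightarrow> complex \<Rightarrow> complex^'n^'n"
  where "matrix_divided_difference \<alpha> F l = (\<chi> i k. divided_difference \<alpha> (\<lambda>z. F z $ i $ k) l)"

lemma matrix_divided_difference_neq:
  "l \<noteq> \<alpha> \<Longrightarrow> matrix_divided_difference \<alpha> F l = (1 / (l - \<alpha>)) *\<^sub>m (F l - F \<alpha>)"
  by (simp add: vec_eq_iff matrix_divided_difference_def divided_difference_def)

lemma matrix_divided_difference_at: "matrix_divided_difference \<alpha> F \<alpha> = matrix_deriv F \<alpha>"
  by (simp add: vec_eq_iff matrix_divided_difference_def divided_difference_def matrix_deriv_def)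

lemma matrix_divided_difference_const: "matrix_divided_difference \<alpha> (\<lambda>_. A) l = 0"
  by (simp add: vec_eq_iff matrix_divided_difference_def divided_difference_def)

lemma matrix_holomorphic_divided_difference:
  "matrix_holomorphic_on F UNIV \<Longrightarrow> matrix_holomorphic_on (matrix_divided_difference \<alpha> F) UNIV"
  by (simp add: matrix_holomorphic_on_def matrix_divided_difference_def holomorphic_divided_difference)

lemma matrix_holomorphic_const: "matrix_holomorphic_on (\<lambda>_. A) S"
  by (simp add: matrix_holomorphic_on_def)

lemma matrix_holomorphic_add:
  "matrix_holomorphic_on F S \<Longrightarrow> matrix_holomorphic_on G S \<Longrightarrow> matrix_holomorphic_on (\<lambda>l. F l + G l) S"
  by (simp add: matrix_holomorphic_on_def holomorphic_on_add)

lemma matrix_holomorphic_diff: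
  "matrix_holomorphic_on F S \<Longrightarrow> matrix_holomorphic_on G S \<Longrightarrow> matrix_holomorphic_on (\<lambda>l. F l - G l) S"
  by (simp add: matrix_holomorphic_on_def holomorphic_on_diff)

lemma matrix_holomorphic_mult:
  "matrix_holomorphic_on F S \<Longrightarrow> matrix_holomorphic_on G S \<Longrightarrow> matrix_holomorphic_on (\<lambda>l. F l ** G l) S"
  by (simp add: matrix_holomorphic_on_def matrix_matrix_mult_def holomorphic_on_sum holomorphic_on_mult)

lemma smooth_on_matrix_divided_difference:
  fixes F :: "'a::euclidean_space \<Rightarrow> complex \<Rightarrow> complex^'n^'n"
  assumes "open U" "smooth_on (U \<times> UNIV) (\<lambda>(p, l). F p l)"
    and "\<And>p. p \<in> U \<Longrightarrow> matrix_holomorphic_on (F p) UNIV"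
  shows "smooth_on (U \<times> UNIV) (\<lambda>(p, l). matrix_divided_difference \<alpha> (F p) l)"
proof -
  have op: "open (U \<times> (UNIV :: complex set))" using assms(1) by (simp add: open_Times)
  have "smooth_on (U \<times> UNIV) (\<lambda>(p, l). divided_difference \<alpha> (\<lambda>z. F p z $ i $ k) l)" for i k
  proof (rule smooth_on_divided_difference[OF assms(1)])
    show "smooth_on (U \<times> UNIV) (\<lambda>(p, l). F p l $ i $ k)"
      using Ck_on_vec_nth[OF op Ck_on_vec_nth[OF op smooth_on_Ck[OF assms(2)]]]
      by (simp add: smooth_on_def case_prod_unfold)
  qed (use assms(3) in \<open>simp add: matrix_holomorphic_on_def\<close>)
  then show ?thesis
    using op unfolding smooth_on_def
    by (auto intro!: Ck_on_matrix simp: matrix_divided_difference_def case_prod_unfold)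
qed

lemma smooth_on_slice:
  fixes F :: "'a::euclidean_space \<Rightarrow> complex \<Rightarrow> complex^'n^'n"
  assumes "open U" "smooth_on (U \<times> UNIV) (\<lambda>(p, l). F p l)"
  shows "smooth_on U (\<lambda>p. F p l)"
proof -
  have "smooth_on U (\<lambda>p. (p, l))"
    by (rule smooth_on_Pair[OF assms(1) smooth_on_bounded_linear[OF bounded_linear_ident assms(1)] smooth_on_const])
  from smooth_on_compose[OF assms(1) _ _ assms(2) this] show ?thesis
    using assms(1) by (auto simp: open_Times)
qed

lemma smooth_on_fst:
  fixes f :: "'a::euclidean_space \<Rightarrow> 'c::real_normed_vector" and T :: "'b::euclidean_space set"
  assumes "open U" "open T" "smooth_on U f"
  shows "smooth_on (U \<times> T) (\<lambda>q. f (fst q))"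
  by (rule smooth_on_compose[OF _ assms(1) _ assms(3) smooth_on_bounded_linear[OF bounded_linear_fst]])
     (use assms in \<open>auto simp: open_Times\<close>)

text \<open>With \<open>m = l - \<alpha>\<close>, this turns the logarithmic derivative
  \<open>A\<close> of a frame into that of the frame times \<open>mat 1 - c *\<^sub>m X\<close>; the
  bracket after the second \<open>c\<close> is the derivative of \<open>X\<close>.\<close>

lemma gauge_identity:
  assumes "X ** X = 0" "c * m = 1" "A = A0 + m *\<^sub>m D" "D = D0 + m *\<^sub>m D2"
  shows "A ** (mat 1 - c *\<^sub>m X) - c *\<^sub>m (X ** A0 - A0 ** X - X ** D0 ** X)
    = (mat 1 - c *\<^sub>m X) ** (A + commutator X D - X ** D2 ** X)"
proof -
  have XX: "Z ** X ** X = 0" for Z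
    by (metis assms(1) matrix_mul_assoc times0_right)
  \<comment> \<open>Each factor \<open>c\<close> is traded for the next divided difference. Then the
    polar terms on both sides match, apart from products containing \<open>X ** X\<close>, which
    vanish.\<close>
  have "c *\<^sub>m A = c *\<^sub>m A0 + D" "c *\<^sub>m D = c *\<^sub>m D0 + D2"
    by (simp_all only: assms(3,4) cscale_add_right[of c] cscale_cscale[of c] assms(2) cscale_one)
  then have eqs: "c *\<^sub>m (A ** X) = c *\<^sub>m (A0 ** X) + D ** X"
    "c *\<^sub>m (X ** A) = c *\<^sub>m (X ** A0) + X ** D"
    "c *\<^sub>m (X ** D ** X) = c *\<^sub>m (X ** D0 ** X) + X ** D2 ** X"
    by (metis cscale_mult_left cscale_mult_right matrix_add_ldistrib matrix_add_rdistrib)+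
  show ?thesis
    by (simp add: matrix_expand assms(1) XX eqs)
qed

subsection \<open>The dressed frame\<close>

lemmas continuous_on_matrix_mult = bounded_bilinear.continuous_on[OF bounded_bilinear_matrix_mult]

locale holomorphic_family =
  fixes U :: "'a::euclidean_space set" and E :: "'a \<Rightarrow> complex \<Rightarrow> complex^'n^'n"
  assumes open_U: "open U"
    and smooth_E: "smooth_on (U \<times> UNIV) (\<lambda>(p, l). E p l)"
    and hol_E: "p \<in> U \<Longrightarrow> matrix_holomorphic_on (E p) UNIV"
begin

lemma smooth_dd:
  "smooth_on (U \<times> UNIV) (\<lambda>(p, l). matrix_divided_difference \<alpha> (E p) l)"
  "smooth_on (U \<times> UNIV) (\<lambda>(p, l). matrix_divided_difference \<alpha> (matrix_divided_difference \<alpha> (E p)) l)"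
  by (intro smooth_on_matrix_divided_difference open_U smooth_E hol_E
      matrix_holomorphic_divided_difference; assumption)+

lemma smooth_E_at: "smooth_on U (\<lambda>p. E p l)"
  by (rule smooth_on_slice[OF open_U smooth_E])

lemma smooth_matrix_deriv: "smooth_on U (\<lambda>p. matrix_deriv (E p) \<alpha>)"
  using smooth_on_slice[OF open_U smooth_dd(1)[of \<alpha>], of \<alpha>] by (simp add: matrix_divided_difference_at)

end

text \<open>For invertible \<open>E p \<alpha>\<close>, the invertibility assumed here is the
  condition defining \<open>N_tilde_domain\<close>, multiplied on the right by
  \<open>E p \<alpha>\<close>.\<close>

locale dressing = holomorphic_family U E
  for U :: "'a::euclidean_space set" and E :: "'a \<Rightarrow> complex \<Rightarrow> complex^'n^'n" +
  fixes \<alpha> :: complex and N :: "complex^'n^'n"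
  assumes NN: "N ** N = 0"
    and invertible_gauge: "p \<in> U \<Longrightarrow> invertible (E p \<alpha> + N ** matrix_deriv (E p) \<alpha>)"
begin

definition gauge :: "'a \<Rightarrow> complex^'n^'n"
  where "gauge p = E p \<alpha> + N ** matrix_deriv (E p) \<alpha>"

definition Nt :: "'a \<Rightarrow> complex^'n^'n"
  where "Nt p = matrix_inv (gauge p) ** N ** gauge p"

text \<open>The entire extension of \<open>m E m'\<^sup>-\<^sup>1\<close> across its removable singularity \<open>\<alpha>\<close>; see \<open>Et_eq\<close>.\<close>
definition Et :: "'a \<Rightarrow> complex \<Rightarrow> complex^'n^'n"
  where "Et p l = E p l + N ** matrix_divided_difference \<alpha> (E p) l
    - matrix_divided_difference \<alpha> (E p) l ** Nt p
    - N ** matrix_divided_difference \<alpha> (matrix_divided_difference \<alpha> (E p)) l ** Nt p"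

lemma gauge_Nt: "p \<in> U \<Longrightarrow> gauge p ** Nt p = N ** gauge p"
  using invertible_gauge[of p] by (simp add: Nt_def gauge_def matrix_mul_assoc matrix_inv_right)

lemma N_gauge: "N ** gauge p = N ** E p \<alpha>"
  by (simp add: gauge_def matrix_add_ldistrib matrix_mul_assoc NN)

lemma Nt_Nt: "p \<in> U \<Longrightarrow> Nt p ** Nt p = 0"
proof -
  assume p: "p \<in> U"
  have "Nt p ** Nt p = matrix_inv (gauge p) ** N ** (gauge p ** Nt p)"
    by (simp add: Nt_def matrix_mul_assoc)
  also have "\<dots> = matrix_inv (gauge p) ** (N ** N) ** gauge p"
    by (simp only: gauge_Nt[OF p] matrix_mul_assoc)
  finally show ?thesis by (simp add: NN)
qed

text \<open>Each \<open>c\<close> times a function of \<open>l\<close> becomes \<open>c\<close>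
  times its value at \<open>\<alpha>\<close> plus a divided difference. The double pole and the
  simple pole then have coefficients that vanish by \<open>NEX\<close> and
  \<open>rel\<close>.\<close>

lemma Et_eq:
  assumes p: "p \<in> U" and l: "l \<noteq> \<alpha>"
  shows "Et p l = (mat 1 + (1 / (l - \<alpha>)) *\<^sub>m N) ** E p l ** (mat 1 - (1 / (l - \<alpha>)) *\<^sub>m Nt p)"
proof -
  define c where "c = 1 / (l - \<alpha>)"
  let ?d1 = "matrix_divided_difference \<alpha> (E p)"
  let ?d2 = "matrix_divided_difference \<alpha> ?d1"
  have cF: "c *\<^sub>m F l = c *\<^sub>m F \<alpha> + matrix_divided_difference \<alpha> F l" for F :: "complex \<Rightarrow> complex^'n^'n"
    by (simp add: matrix_divided_difference_neq[OF l] c_def cscale_diff_right)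
  have cN: "c *\<^sub>m (N ** F l) = c *\<^sub>m (N ** F \<alpha>) + N ** matrix_divided_difference \<alpha> F l"
    for F :: "complex \<Rightarrow> complex^'n^'n"
    unfolding cscale_mult_right[symmetric] cF[of F] matrix_add_ldistrib ..
  have cX: "c *\<^sub>m (F l ** Nt p) = c *\<^sub>m (F \<alpha> ** Nt p) + matrix_divided_difference \<alpha> F l ** Nt p"
    for F :: "complex \<Rightarrow> complex^'n^'n"
    unfolding cscale_mult_left[symmetric] cF[of F] matrix_add_rdistrib ..
  have cNX: "c *\<^sub>m (N ** F l ** Nt p) = c *\<^sub>m (N ** F \<alpha> ** Nt p) + N ** matrix_divided_difference \<alpha> F l ** Nt p"
    for F :: "complex \<Rightarrow> complex^'n^'n"
    using arg_cong[OF cN[of F], of "\<lambda>Z. Z ** Nt p"] by (simp only: matrix_add_rdistrib cscale_mult_left)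
  note eqs = cN[of "E p"] cX[of "E p"] cNX[of "E p"] cNX[of ?d1, unfolded matrix_divided_difference_at]
  \<comment> \<open>Replacing \<open>E p \<alpha>\<close> by \<open>gauge p\<close> after
    \<open>N\<close> and intertwining gives \<open>N ** N ** gauge p\<close>.\<close>
  have NEX: "N ** E p \<alpha> ** Nt p = 0"
    by (simp only: N_gauge[symmetric] matrix_mul_assoc[symmetric] gauge_Nt[OF p])
       (simp add: matrix_mul_assoc NN)
  \<comment> \<open>Both sides equal \<open>gauge p ** Nt p\<close>; this is the vanishing of the
    residue.\<close>
  have "E p \<alpha> ** Nt p + N ** matrix_deriv (E p) \<alpha> ** Nt p = N ** E p \<alpha>"
    using gauge_Nt[OF p] N_gauge[of p] by (simp add: gauge_def[of p] matrix_add_rdistrib)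
  from this[symmetric] have rel: "c *\<^sub>m (N ** E p \<alpha>) =
      c *\<^sub>m (E p \<alpha> ** Nt p) + c *\<^sub>m (N ** matrix_deriv (E p) \<alpha> ** Nt p)"
    by (simp add: cscale_add_right)
  have "(mat 1 + c *\<^sub>m N) ** E p l ** (mat 1 - c *\<^sub>m Nt p)
      = E p l + c *\<^sub>m (N ** E p l) - c *\<^sub>m (E p l ** Nt p) - c *\<^sub>m (c *\<^sub>m (N ** E p l ** Nt p))"
    by (simp add: matrix_expand)
  also have "\<dots> = Et p l"
    by (simp add: eqs NEX rel Et_def)
  finally show ?thesis by (simp add: c_def)
qed

lemma smooth_gauge: "smooth_on U gauge"
  unfolding gauge_def[abs_def]
  by (rule smooth_on_add[OF open_U smooth_E_at smooth_on_mult[OF open_U smooth_on_const smooth_matrix_deriv]])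

lemma smooth_Nt: "smooth_on U Nt"
proof -
  have "smooth_on U (\<lambda>p. matrix_inv (gauge p))"
    using Ck_on_matrix_inv[OF open_U smooth_on_Ck[OF smooth_gauge]] invertible_gauge
    by (simp add: smooth_on_def gauge_def)
  from smooth_on_mult[OF open_U smooth_on_mult[OF open_U this smooth_on_const] smooth_gauge]
  show ?thesis by (simp add: Nt_def[abs_def])
qed

lemma smooth_Et: "smooth_on (U \<times> UNIV) (\<lambda>(p, l). Et p l)"
proof -
  have op: "open (U \<times> (UNIV :: complex set))" using open_U by (simp add: open_Times)
  note Nt = smooth_on_fst[OF open_U open_UNIV smooth_Nt]
  show ?thesis
    unfolding Et_def case_prod_unfold
    by (rule smooth_on_diff[OF op smooth_on_diff[OF op smooth_on_add[OF op smooth_E[unfolded case_prod_unfold]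
        smooth_on_mult[OF op smooth_on_const smooth_dd(1)[unfolded case_prod_unfold]]]
        smooth_on_mult[OF op smooth_dd(1)[unfolded case_prod_unfold] Nt]]
        smooth_on_mult[OF op smooth_on_mult[OF op smooth_on_const smooth_dd(2)[unfolded case_prod_unfold]] Nt]])
qed

lemma holomorphic_Et: "p \<in> U \<Longrightarrow> matrix_holomorphic_on (Et p) UNIV"
  unfolding Et_def
  by (intro matrix_holomorphic_diff matrix_holomorphic_add matrix_holomorphic_mult
      matrix_holomorphic_const matrix_holomorphic_divided_difference hol_E)

text \<open>This yields invertibility of \<open>Et\<close> also at \<open>l = \<alpha>\<close>,
  where the factors have poles.\<close>

lemma det_Et: "p \<in> U \<Longrightarrow> det (Et p l) = det (E p l)"
proof -
  assume p: "p \<in> U"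
  have *: "det (Et p l) = det (E p l)" if "l \<noteq> \<alpha>" for l
  proof -
    define c where "c = 1 / (l - \<alpha>)"
    \<comment> \<open>The intertwining by \<open>gauge p\<close> makes the two factors similar, so
      their determinants agree.\<close>
    have "gauge p ** (mat 1 - c *\<^sub>m Nt p) = (mat 1 - c *\<^sub>m N) ** gauge p"
      by (simp add: matrix_expand gauge_Nt[OF p])
    then have "det (gauge p) * det (mat 1 - c *\<^sub>m Nt p) = det (mat 1 - c *\<^sub>m N) * det (gauge p)"
      by (metis det_mul)
    then have "det (mat 1 - c *\<^sub>m Nt p) = det (mat 1 - c *\<^sub>m N)"
      using invertible_gauge[OF p] by (simp add: gauge_def invertible_det_nz)
    moreover have "(mat 1 + c *\<^sub>m N) ** (mat 1 - c *\<^sub>m N) = mat 1"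
      by (simp add: matrix_expand NN)
    then have "det (mat 1 + c *\<^sub>m N) * det (mat 1 - c *\<^sub>m N) = 1"
      by (metis det_I det_mul)
    ultimately show ?thesis
      by (simp add: Et_eq[OF p that] det_mul flip: c_def)
  qed
  have "continuous_on UNIV (\<lambda>l. det (F l))" if "matrix_holomorphic_on F UNIV" for F :: "complex \<Rightarrow> complex^'n^'n"
    using that unfolding det_def matrix_holomorphic_on_def
    by (intro holomorphic_on_imp_continuous_on holomorphic_on_sum holomorphic_on_mult
        holomorphic_on_const holomorphic_on_prod) auto
  from continuous_eq_removable[OF this[OF holomorphic_Et[OF p]] this[OF hol_E[OF p]] *] *
  show ?thesis by (cases "l = \<alpha>") auto
qed

text \<open>\<open>A\<close> is the logarithmic derivative of the frame at \<open>p\<close> in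
  direction \<open>v\<close>, and \<open>D\<close>, \<open>D2\<close> are its successive divided
  differences at \<open>\<alpha>\<close>. In the x-direction they are \<open>a\<close> and 0; in the
  t-direction they are iterated Horner sums.\<close>

context
  fixes v p A D D2
  assumes p: "p \<in> U"
    and E_A: "\<And>l. has_partial_derivative v (\<lambda>q. E q l) (E p l ** A l) p"
    and A: "\<And>l. A l = A \<alpha> + (l - \<alpha>) *\<^sub>m D l"
    and D: "\<And>l. D l = D \<alpha> + (l - \<alpha>) *\<^sub>m D2 l"
    and cont_D2: "continuous_on UNIV D2"
begin

lemma cont_linear:
  assumes "continuous_on UNIV B"
  shows "continuous_on UNIV (\<lambda>l. C + (l - \<alpha>) *\<^sub>m B l)"
  by (rule continuous_on_add[OF continuous_on_const
      bounded_bilinear.continuous_on[OF bounded_bilinear_cscale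
        continuous_on_diff[OF continuous_on_id continuous_on_const] assms]])

lemma cont_D: "continuous_on UNIV D"
  using cont_linear[OF cont_D2, of "D \<alpha>"] unfolding D[symmetric] .

lemma cont_A: "continuous_on UNIV A"
  using cont_linear[OF cont_D, of "A \<alpha>"] unfolding A[symmetric] .

lemma cont_slice:
  assumes "smooth_on (U \<times> UNIV) (\<lambda>(p, l). F p l)"
  shows "continuous_on UNIV (F p)"
  using continuous_on_compose2[OF smooth_on_continuous[OF assms], of UNIV "\<lambda>l. (p, l)"] p
  by (auto simp: continuous_on_Pair)

text \<open>A mixed second derivative, obtained by differentiating the difference quotient for
  \<open>l \<noteq> \<alpha>\<close> and letting \<open>l\<close> tend to
  \<open>\<alpha>\<close>.\<close>

lemma deriv_partial:
  "has_partial_derivative v (\<lambda>q. matrix_deriv (E q) \<alpha>) (matrix_deriv (E p) \<alpha> ** A \<alpha> + E p \<alpha> ** D \<alpha>) p"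
proof -
  let ?G = "\<lambda>l. matrix_divided_difference \<alpha> (E p) l ** A \<alpha> + E p l ** D l"
  have "has_partial_derivative v (\<lambda>q. matrix_divided_difference \<alpha> (E q) l) (?G l) p" if "l \<noteq> \<alpha>" for l
  proof -
    have "(1 / (l - \<alpha>)) *\<^sub>m (E p l ** A l - E p \<alpha> ** A \<alpha>) = ?G l"
      using that unfolding A[of l] by (simp add: matrix_divided_difference_neq matrix_expand)
    then show ?thesis
      using has_partial_derivative_cscale[OF has_partial_derivative_diff[OF E_A[of l] E_A[of \<alpha>]], of "1 / (l - \<alpha>)"]
      by (simp add: matrix_divided_difference_neq[OF that])
  qed
  moreover have "continuous_on UNIV ?G"
    by (intro continuous_on_add continuous_on_matrix_mult
        cont_slice[OF smooth_dd(1)] cont_slice[OF smooth_E] cont_D continuous_on_const)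
  ultimately have "has_partial_derivative v (\<lambda>q. matrix_divided_difference \<alpha> (E q) \<alpha>) (?G \<alpha>) p"
    using has_partial_derivative_removable[OF smooth_dd(1) p, of ?G] by blast
  then show ?thesis by (simp add: matrix_divided_difference_at)
qed

text \<open>The terms with \<open>A \<alpha>\<close> assemble to
  \<open>gauge p ** A \<alpha>\<close>; the other one is
  \<open>N ** E p \<alpha> ** D \<alpha>\<close>, and
  \<open>N ** E p \<alpha> = gauge p ** Nt p\<close>.\<close>

lemma gauge_partial: "has_partial_derivative v gauge (gauge p ** (A \<alpha> + Nt p ** D \<alpha>)) p"
proof -
  have "has_partial_derivative v gauge
      (E p \<alpha> ** A \<alpha> + N ** (matrix_deriv (E p) \<alpha> ** A \<alpha> + E p \<alpha> ** D \<alpha>)) p"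
    unfolding gauge_def[abs_def]
    by (rule has_partial_derivative_add[OF E_A has_partial_derivative_cmult[OF deriv_partial]])
  moreover have "gauge p ** (A \<alpha> + Nt p ** D \<alpha>) =
      E p \<alpha> ** A \<alpha> + N ** (matrix_deriv (E p) \<alpha> ** A \<alpha> + E p \<alpha> ** D \<alpha>)"
    by (simp add: matrix_add_ldistrib matrix_mul_assoc gauge_Nt[OF p] N_gauge)
       (simp add: gauge_def matrix_expand)
  ultimately show ?thesis by simp
qed

text \<open>Differentiating \<open>gauge q ** Nt q = N ** gauge q\<close> avoids differentiating an
  inverse and gives the commutator of \<open>Nt p\<close> with \<open>?W\<close>; one of its terms
  dies with the square of \<open>Nt p\<close>.\<close>

lemma Nt_partial:
  "has_partial_derivative v Nt (Nt p ** A \<alpha> - A \<alpha> ** Nt p - Nt p ** D \<alpha> ** Nt p) p"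
proof -
  let ?W = "A \<alpha> + Nt p ** D \<alpha>"
  obtain Nt' where Nt': "has_partial_derivative v Nt Nt' p"
    using smooth_on_has_partial_derivative[OF smooth_Nt p] by blast
  have "has_partial_derivative v (\<lambda>q. N ** gauge q) (gauge p ** Nt' + gauge p ** ?W ** Nt p) p"
    by (rule has_partial_derivative_cong[OF open_U p _ has_partial_derivative_mult[OF gauge_partial Nt']])
       (simp add: gauge_Nt)
  from has_partial_derivative_unique[OF this has_partial_derivative_cmult[OF gauge_partial]]
  have "gauge p ** Nt' + gauge p ** ?W ** Nt p = gauge p ** Nt p ** ?W"
    by (simp add: matrix_mul_assoc gauge_Nt[OF p])
  then have "gauge p ** Nt' = gauge p ** (Nt p ** ?W - ?W ** Nt p)"
    by (simp add: matrix_diff_ldistrib matrix_mul_assoc eq_diff_eq)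
  then have "Nt' = Nt p ** ?W - ?W ** Nt p"
    by (metis invertible_gauge[OF p] gauge_def matrix_inv_left matrix_mul_assoc matrix_mul_lid)
  also have "\<dots> = Nt p ** A \<alpha> - A \<alpha> ** Nt p - Nt p ** D \<alpha> ** Nt p"
    by (simp add: matrix_expand Nt_Nt[OF p])
  finally show ?thesis using Nt' by simp
qed

lemma Et_partial:
  "has_partial_derivative v (\<lambda>q. Et q l) (Et p l ** (A l + commutator (Nt p) (D l) - Nt p ** D2 l ** Nt p)) p"
proof (rule has_partial_derivative_removable[OF smooth_Et p])
  show "continuous_on UNIV (\<lambda>l. Et p l ** (A l + commutator (Nt p) (D l) - Nt p ** D2 l ** Nt p))"
    unfolding commutator_def
    by (intro continuous_on_add continuous_on_diff continuous_on_matrix_mult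
        cont_slice[OF smooth_Et] cont_A cont_D cont_D2 continuous_on_const)
  fix l assume l: "l \<noteq> \<alpha>"
  define c where "c = 1 / (l - \<alpha>)"
  let ?Nt' = "Nt p ** A \<alpha> - A \<alpha> ** Nt p - Nt p ** D \<alpha> ** Nt p"
  have "has_partial_derivative v (\<lambda>q. mat 1 - c *\<^sub>m Nt q) (0 - c *\<^sub>m ?Nt') p"
    by (rule has_partial_derivative_diff[OF has_partial_derivative_const has_partial_derivative_cscale[OF Nt_partial]])
  from has_partial_derivative_mult[OF has_partial_derivative_cmult[OF E_A, of "mat 1 + c *\<^sub>m N" l] this]
  have "has_partial_derivative v (\<lambda>q. Et q l)
      ((mat 1 + c *\<^sub>m N) ** E p l ** (A l ** (mat 1 - c *\<^sub>m Nt p) - c *\<^sub>m ?Nt')) p"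
    using has_partial_derivative_cong[OF open_U p, of "\<lambda>q. (mat 1 + c *\<^sub>m N) ** E q l ** (mat 1 - c *\<^sub>m Nt q)"
        "\<lambda>q. Et q l"]
    by (simp add: Et_eq[OF _ l] c_def matrix_mul_assoc matrix_diff_ldistrib matrix_minus_right)
  moreover have "c * (l - \<alpha>) = 1" using l by (simp add: c_def)
  note gauge_identity[OF Nt_Nt[OF p] this A D]
  ultimately show "has_partial_derivative v (\<lambda>q. Et q l)
      (Et p l ** (A l + commutator (Nt p) (D l) - Nt p ** D2 l ** Nt p)) p"
    by (simp only: Et_eq[OF p l] c_def[symmetric] matrix_mul_assoc)
qed

end

end

subsection \<open>The dressed series\<close>

text \<open>
  \<open>horner l A n = (\<Sum>k<n. l ^ (n - 1 - k) A k)\<close>. For fixed \<open>l\<close> these are also the coefficients of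
  \<open>(\<Sum>k. A k z ^ k) z / (1 - l z)\<close>, that is, of the series divided by \<open>\<lambda> - l\<close> for \<open>z = 1/\<lambda>\<close>.
\<close>
primrec horner :: "complex \<Rightarrow> (nat \<Rightarrow> complex^'n^'n) \<Rightarrow> nat \<Rightarrow> complex^'n^'n"
  where
    "horner l A 0 = 0"
  | "horner l A (Suc i) = A i + l *\<^sub>m horner l A i"

lemma horner_eq_sum: "l ^ j *\<^sub>m A 0 + (\<Sum>i = 1..j. l ^ (j - i) *\<^sub>m A i) = horner l A (Suc j)"
proof (induction j)
  case (Suc j)
  have "(\<Sum>i = 1..j. l ^ (Suc j - i) *\<^sub>m A i) = (\<Sum>i = 1..j. l *\<^sub>m (l ^ (j - i) *\<^sub>m A i))"
    by (rule sum.cong) (auto simp: cscale_cscale Suc_diff_le)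
  also have "\<dots> = l *\<^sub>m (\<Sum>i = 1..j. l ^ (j - i) *\<^sub>m A i)"
    by (simp add: vec_eq_iff sum_distrib_left)
  finally have "l ^ Suc j *\<^sub>m A 0 + (\<Sum>i = 1..Suc j. l ^ (Suc j - i) *\<^sub>m A i) =
      l *\<^sub>m (l ^ j *\<^sub>m A 0 + (\<Sum>i = 1..j. l ^ (j - i) *\<^sub>m A i)) + A (Suc j)"
    by (simp add: cscale_add_right cscale_cscale add.assoc)
  then show ?case unfolding Suc.IH by (simp add: add.commute)
qed simp

text \<open>Synthetic division: the intermediate Horner values at \<open>\<alpha>\<close> are the
  coefficients of the quotient by \<open>l - \<alpha>\<close>. Iterating \<open>horner\<close> thus
  produces the divided differences required above.\<close>

lemma horner_horner: "(l - \<alpha>) *\<^sub>m horner l (horner \<alpha> A) n = horner l A n - horner \<alpha> A n"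
proof (induction n)
  case (Suc n)
  have "(l - \<alpha>) *\<^sub>m horner l (horner \<alpha> A) (Suc n)
      = (l - \<alpha>) *\<^sub>m horner \<alpha> A n + l *\<^sub>m ((l - \<alpha>) *\<^sub>m horner l (horner \<alpha> A) n)"
    by (simp add: vec_eq_iff algebra_simps)
  then show ?case unfolding Suc.IH by (simp add: vec_eq_iff algebra_simps)
qed simp

lemma horner_shift:
  "horner l A n = horner \<alpha> A n + (l - \<alpha>) *\<^sub>m horner l (horner \<alpha> A) n"
  by (simp add: horner_horner)

lemma continuous_on_horner: "continuous_on UNIV (\<lambda>l. horner l A n)"
proof (induction n)
  case (Suc n)
  show ?case
    using continuous_on_add[OF continuous_on_const
        bounded_bilinear.continuous_on[OF bounded_bilinear_cscale continuous_on_id Suc]]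
    by simp
qed simp

lemma smooth_on_horner:
  "open S \<Longrightarrow> (\<And>i. smooth_on S (\<lambda>p. A i p)) \<Longrightarrow> smooth_on S (\<lambda>p. horner l (\<lambda>i. A i p) n)"
  by (induction n) (simp_all add: smooth_on_const smooth_on_add smooth_on_cscale)

text \<open>The coefficients in \<open>1/\<lambda>\<close> of the series conjugated by \<open>1 + X / (\<lambda> - \<alpha>)\<close>, provided \<open>X\<^sup>2 = 0\<close>.\<close>
definition dressed :: "complex \<Rightarrow> complex^'n^'n \<Rightarrow> (nat \<Rightarrow> complex^'n^'n) \<Rightarrow> nat \<Rightarrow> complex^'n^'n"
  where "dressed \<alpha> X A i =
    A i + commutator X (horner \<alpha> A i) - X ** horner \<alpha> (horner \<alpha> A) i ** X"

lemma dressed_0: "dressed \<alpha> X A 0 = A 0"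
  by (simp add: dressed_def commutator_def)

text \<open>Cyclicity brings the two outer factors \<open>X\<close> of the last term together, and
  the commutator is traceless.\<close>

lemma trace_dressed:
  assumes "X ** X = 0" "\<And>i. trace (A i) = 0"
  shows "trace (dressed \<alpha> X A i) = 0"
proof -
  have "trace (X ** (horner \<alpha> (horner \<alpha> A) i ** X)) = 0"
    by (subst trace_mul_sym) (simp add: matrix_mul_assoc[symmetric] assms(1) trace_0[simplified])
  then show ?thesis
    by (simp add: dressed_def trace_add trace_sub trace_commutator assms(2) matrix_mul_assoc)
qed

text \<open>Horner sums are linear in the sequence, so dressing passes through them. The right side
  is the transformed logarithmic derivative of \<open>Et_partial\<close>, with iterated Horner sums
  as \<open>D\<close> and \<open>D2\<close>.\<close>

lemma horner_dressed:
  "horner l (dressed \<alpha> X A) n =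
    horner l A n + commutator X (horner l (horner \<alpha> A) n) - X ** horner l (horner \<alpha> (horner \<alpha> A)) n ** X"
proof (induction n)
  case (Suc n)
  have *: "horner l (dressed \<alpha> X A) (Suc n) = dressed \<alpha> X A n + l *\<^sub>m (horner l A n
      + commutator X (horner l (horner \<alpha> A) n) - X ** horner l (horner \<alpha> (horner \<alpha> A)) n ** X)"
    by (simp add: Suc)
  show ?case unfolding * by (simp add: dressed_def matrix_expand algebra_simps)
qed (simp add: commutator_def)

lemma smooth_on_dressed:
  assumes "open S" "smooth_on S X" "\<And>i. smooth_on S (\<lambda>p. A i p)"
  shows "smooth_on S (\<lambda>p. dressed \<alpha> (X p) (\<lambda>i. A i p) i)"
proof -
  note h = smooth_on_horner[OF assms(1) assms(3), of \<alpha>]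
  note h2 = smooth_on_horner[OF assms(1) h, of \<alpha>]
  show ?thesis
    unfolding dressed_def
    by (rule smooth_on_diff[OF assms(1) smooth_on_add[OF assms(1) assms(3)
          smooth_on_commutator[OF assms(1,2) h]] smooth_on_mult[OF assms(1)
          smooth_on_mult[OF assms(1,2) h2] assms(2)]])
qed

text \<open>The recursion is linear and is inherited by Horner sums. At \<open>n = 0\<close> the sum
  on the right is \<open>A 0\<close>, whose commutator with \<open>a\<close> must vanish.\<close>

lemma horner_partial:
  assumes "\<And>i. has_partial_derivative v (A i) (commutator (A (Suc i) p) a - commutator u (A i p)) p"
    and "commutator (A 0 p) a = 0"
  shows "has_partial_derivative v (\<lambda>q. horner \<alpha> (\<lambda>i. A i q) n)
    (commutator (horner \<alpha> (\<lambda>i. A i p) (Suc n)) a - commutator u (horner \<alpha> (\<lambda>i. A i p) n)) p"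
proof (induction n)
  case 0
  then show ?case using assms(2) by (simp add: has_partial_derivative_const commutator_def)
next
  case (Suc n)
  from has_partial_derivative_add[OF assms(1)[of n] has_partial_derivative_cscale[OF Suc, of \<alpha>]]
  show ?case by (simp add: matrix_expand algebra_simps)
qed

text \<open>The algebra behind the recursion for the dressed series: the left side is the product
  rule for \<open>Q + [X, S] - X S' X\<close> with \<open>T\<close> in place of \<open>S'\<close>,
  where \<open>S\<close>, \<open>T\<close> are the first and second Horner sums and the suffix 1
  marks the next index.\<close>

lemma dressed_identity:
  assumes "X ** X = 0"
    and "X' = X ** (\<alpha> *\<^sub>m a + u) - (\<alpha> *\<^sub>m a + u) ** X - X ** a ** X"
    and "S1 = Q + \<alpha> *\<^sub>m S" "T1 = S + \<alpha> *\<^sub>m T"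
    and "Q' = commutator Q1 a - commutator u Q" "S' = commutator S1 a - commutator u S"
      "T' = commutator T1 a - commutator u T"
  shows "Q' + (X ** S' + X' ** S - (S ** X' + S' ** X)) - ((X ** T) ** X' + (X ** T' + X' ** T) ** X)
    = commutator (Q1 + commutator X S1 - X ** T1 ** X) a
      - commutator (u - commutator a X) (Q + commutator X S - X ** T ** X)"
proof -
  have XX: "Z ** X ** X = 0" for Z
    by (metis assms(1) matrix_mul_assoc times0_right)
  show ?thesis
    unfolding assms(2-) by (simp add: matrix_expand assms(1) XX)
qed

lemma dressed_partial:
  assumes "\<And>i. has_partial_derivative v (A i) (commutator (A (Suc i) p) a - commutator u (A i p)) p"
    and "commutator (A 0 p) a = 0" "X p ** X p = 0"
    and "has_partial_derivative v X
      (X p ** (\<alpha> *\<^sub>m a + u) - (\<alpha> *\<^sub>m a + u) ** X p - X p ** a ** X p) p"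
  shows "has_partial_derivative v (\<lambda>q. dressed \<alpha> (X q) (\<lambda>i. A i q) i)
    (commutator (dressed \<alpha> (X p) (\<lambda>i. A i p) (Suc i)) a
      - commutator (u - commutator a (X p)) (dressed \<alpha> (X p) (\<lambda>i. A i p) i)) p"
proof -
  note S = horner_partial[where A = A, OF assms(1,2), of \<alpha>]
  \<comment> \<open>The Horner sums themselves form a sequence obeying the recursion, starting with
    0, so \<open>horner_partial\<close> applies a second time.\<close>
  have "commutator (horner \<alpha> (\<lambda>i. A i p) 0) a = 0" by (simp add: commutator_def)
  note T = horner_partial[where A = "\<lambda>n q. horner \<alpha> (\<lambda>i. A i q) n", OF S this, of \<alpha>]
  note D = has_partial_derivative_diff[OF has_partial_derivative_add[OF assms(1)[of i]
      has_partial_derivative_diff[OF has_partial_derivative_mult[OF assms(4) S[of i]]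
        has_partial_derivative_mult[OF S[of i] assms(4)]]]
      has_partial_derivative_mult[OF has_partial_derivative_mult[OF assms(4) T[of i]] assms(4)]]
  show ?thesis
    using D
    unfolding dressed_identity[OF assms(3) refl horner.simps(2)[of \<alpha> "\<lambda>i. A i p" i]
        horner.simps(2)[of \<alpha> "horner \<alpha> (\<lambda>i. A i p)" i] refl refl refl]
    unfolding dressed_def commutator_def[of "X _"] .
qed

lemma formal_const_square_zero:
  assumes "X ** X = 0"
  shows "formal_const X ** formal_const X = 0"
proof -
  have "(formal_const X ** formal_const X) $ i $ k = fps_const ((X ** X) $ i $ k)" for i k
    by (simp add: fps_eq_iff formal_const_def matrix_matrix_mult_def fps_sum_nth)
  then show ?thesis by (simp add: vec_eq_iff assms)
qed

text \<open>The Horner step says \<open>s = z (q + \<alpha> s)\<close> for the series, and solving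
  for \<open>s\<close> gives the factor \<open>z / (1 - \<alpha> z)\<close>, which is
  \<open>1 / (\<lambda> - \<alpha>)\<close>.\<close>

lemma formal_series_horner:
  "formal_series (horner \<alpha> A) =
    mat (fps_X * inverse (1 - fps_const \<alpha> * fps_X)) ** formal_series A"
proof -
  let ?d = "1 - fps_const \<alpha> * fps_X :: complex fps"
  have "formal_series (horner \<alpha> A) $ i $ k = fps_X * inverse ?d * formal_series A $ i $ k" for i k
  proof -
    let ?s = "formal_series (horner \<alpha> A) $ i $ k" and ?q = "formal_series A $ i $ k"
    have "?s = fps_X * (?q + fps_const \<alpha> * ?s)"
    proof (rule fps_ext)
      show "fps_nth ?s n = fps_nth (fps_X * (?q + fps_const \<alpha> * ?s)) n" for n
        by (cases n) (simp_all add: formal_series_def)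
    qed
    then have "?d * ?s = fps_X * ?q" by (simp add: algebra_simps)
    then have "inverse ?d * ?d * ?s = fps_X * inverse ?d * ?q" by (simp add: mult_ac)
    then show ?thesis by (simp add: inverse_mult_eq_1)
  qed
  then show ?thesis
    by (simp add: vec_eq_iff matrix_matrix_mult_def mat_def if_distrib[of "\<lambda>c. c * _"] cong: if_cong)
qed

lemma mat_mult_commute: "A ** mat c = mat c ** (A :: 'a::comm_semiring_1^'n^'n)"
  by (simp add: vec_eq_iff matrix_matrix_mult_def mat_def if_distrib[of "\<lambda>c. c * _"]
      if_distrib[of "\<lambda>c. _ * c"] mult.commute cong: if_cong)

text \<open>The dressed series is the old one conjugated by \<open>?M\<close>, the expansion at
  infinity of \<open>m_factor \<alpha> X\<close>, so \<open>?M ** G\<close> conjugates it to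
  \<open>b\<close>. The scalar matrix \<open>C\<close> commutes with everything.\<close>

lemma formally_conjugate_dressed:
  fixes X b :: "complex^'n^'n"
  assumes "X ** X = 0" "formally_conjugate A b"
  shows "formally_conjugate (dressed \<alpha> X A) b"
proof -
  obtain G where G: "invertible G" "formal_series A = G ** formal_const b ** matrix_inv G"
    using assms(2) by (auto simp: formally_conjugate_def)
  define C :: "complex fps^'n^'n" where "C = mat (fps_X * inverse (1 - fps_const \<alpha> * fps_X))"
  let ?F = "formal_series A" and ?X = "formal_const X"
  have C: "Z ** C = C ** Z" for Z
    by (simp add: C_def mat_mult_commute)
  have C': "Y ** Z ** C = Y ** C ** Z" for Y Z
    by (simp add: C matrix_mul_assoc[symmetric])
  note XX = formal_const_square_zero[OF assms(1)]
  let ?M = "mat 1 + C ** ?X" and ?M' = "mat 1 - C ** ?X"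
  have "C ** ?X ** (C ** ?X) = C ** C ** (?X ** ?X)"
    by (simp add: matrix_mul_assoc C'[of C ?X])
  then have M: "?M ** ?M' = mat 1" "?M' ** ?M = mat 1"
    by (simp_all add: matrix_add_ldistrib matrix_add_rdistrib matrix_diff_ldistrib matrix_diff_rdistrib XX)
  have inv_M: "invertible ?M" using M by (auto simp: invertible_def)
  have add: "formal_series (\<lambda>i. A1 i + A2 i) = formal_series A1 + formal_series A2"
    and diff: "formal_series (\<lambda>i. A1 i - A2 i) = formal_series A1 - formal_series A2"
    for A1 A2 :: "nat \<Rightarrow> complex^'n^'n"
    by (simp_all add: formal_series_def vec_eq_iff fps_eq_iff)
  have cl: "formal_series (\<lambda>i. X ** A1 i) = ?X ** formal_series A1"
    and cr: "formal_series (\<lambda>i. A1 i ** X) = formal_series A1 ** ?X"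
    for A1 :: "nat \<Rightarrow> complex^'n^'n"
    by (simp_all add: formal_series_def formal_const_def vec_eq_iff fps_eq_iff
        matrix_matrix_mult_def fps_sum_nth)
  have "formal_series (dressed \<alpha> X A) =
      ?F + (?X ** (C ** ?F) - C ** ?F ** ?X) - ?X ** (C ** (C ** ?F)) ** ?X"
    unfolding dressed_def[abs_def] commutator_def add diff cl cr formal_series_horner C_def ..
  also have "\<dots> = ?M ** ?F ** ?M'"
    by (simp add: matrix_add_ldistrib matrix_add_rdistrib matrix_diff_ldistrib matrix_diff_rdistrib
        matrix_mul_assoc C[of ?X] C[of ?F] C'[of _ ?X] C'[of _ ?F])
  also have "\<dots> = (?M ** G) ** formal_const b ** matrix_inv (?M ** G)"
    by (simp add: matrix_inv_mult[OF inv_M G(1)] matrix_inv_unique[OF M] G(2) matrix_mul_assoc)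
  finally have "formal_series (dressed \<alpha> X A) = (?M ** G) ** formal_const b ** matrix_inv (?M ** G)" .
  moreover have "invertible (?M ** G)"
    by (rule invertible_mult[OF inv_M G(1)])
  ultimately show ?thesis unfolding formally_conjugate_def by blast
qed

lemma m_factor_inverse:
  assumes "X ** X = 0"
  shows "matrix_inv (m_factor \<alpha> X l) = mat 1 - (1 / (l - \<alpha>)) *\<^sub>m X"
    and "invertible (m_factor \<alpha> X l)"
proof -
  have *: "m_factor \<alpha> X l ** (mat 1 - (1 / (l - \<alpha>)) *\<^sub>m X) = mat 1"
    "(mat 1 - (1 / (l - \<alpha>)) *\<^sub>m X) ** m_factor \<alpha> X l = mat 1"
    by (simp_all add: m_factor_def matrix_expand assms)
  show "matrix_inv (m_factor \<alpha> X l) = mat 1 - (1 / (l - \<alpha>)) *\<^sub>m X"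
    by (rule matrix_inv_unique[OF *])
  show "invertible (m_factor \<alpha> X l)"
    using * by (auto simp: invertible_def)
qed

lemma matrix_deriv_mult_const:
  assumes "matrix_holomorphic_on F UNIV"
  shows "matrix_deriv (\<lambda>l. F l ** C) l = matrix_deriv F l ** C"
proof -
  have "((\<lambda>z. F z $ i $ m) has_field_derivative deriv (\<lambda>z. F z $ i $ m) l) (at l)" for i m
    using assms by (auto simp: matrix_holomorphic_on_def intro!: holomorphic_derivI[OF _ open_UNIV])
  then have "deriv (\<lambda>z. \<Sum>m\<in>UNIV. F z $ i $ m * C $ m $ k) l =
      (\<Sum>m\<in>UNIV. deriv (\<lambda>z. F z $ i $ m) l * C $ m $ k)" for i k
    by (intro DERIV_imp_deriv DERIV_sum DERIV_cmult_right)
  then show ?thesis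
    by (simp add: vec_eq_iff matrix_deriv_def matrix_matrix_mult_def)
qed

subsection \<open>The dressed solution\<close>

lemma has_partial_derivative_commutator_const:
  fixes f :: "'a::real_normed_vector \<Rightarrow> complex^'n^'n"
  assumes "has_partial_derivative v f D p"
  shows "has_partial_derivative v (\<lambda>q. commutator a (f q)) (commutator a D) p"
  using has_partial_derivative_diff[OF has_partial_derivative_cmult[OF assms, of a]
      has_partial_derivative_mult[OF assms has_partial_derivative_const[of v a p]]]
  by (simp add: commutator_def)

lemma commutator_swap: "commutator a b = - commutator b a"
  by (simp add: commutator_def)

lemma commutator_diff_right: "commutator c (a - b) = commutator c a - commutator c b"
  by (simp add: matrix_expand algebra_simps)

text \<open>For \<open>z\<close> commuting with \<open>a\<close>, the trace form moves the
  commutator from \<open>X\<close> onto \<open>z\<close>, where it is zero.\<close>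

lemma sl_perp_diff_commutator:
  assumes "y \<in> sl_perp a"
  shows "y - commutator a X \<in> sl_perp a"
proof -
  have "trace (z ** commutator a X) = 0" if "commutator a z = 0" for z
    using that commutator_swap[of z a] trace_mult_commutator[of z a X] by (simp add: trace_0[simplified])
  then show ?thesis
    using assms
    by (simp add: sl_perp_def sl_def trace_sub trace_commutator matrix_diff_ldistrib)
qed

lemma matrix_holomorphic_transform:
  "matrix_holomorphic_on F S \<Longrightarrow> (\<And>z. z \<in> S \<Longrightarrow> F z = G z) \<Longrightarrow> matrix_holomorphic_on G S"
  unfolding matrix_holomorphic_on_def by (metis (no_types, lifting) holomorphic_transform)

text \<open>In the coordinate \<open>z = 1/\<lambda>\<close> the new factor is
  \<open>mat 1 - (z / (1 - \<alpha> z)) *\<^sub>m X\<close>, holomorphic near 0 with value the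
  identity there. The left factor of \<open>E'\<close> is absorbed by the wave function at the
  origin.\<close>

lemma local_reduced_wave_function_dressing:
  assumes \<omega>: "local_reduced_wave_function a b j U E \<omega>"
    and U': "open U'" "(0, 0) \<in> U'"
    and X: "smooth_on U' X" "\<And>p. p \<in> U' \<Longrightarrow> X p ** X p = 0"
    and E': "\<And>p l. p \<in> U' \<Longrightarrow> l \<noteq> \<alpha> \<Longrightarrow>
      E' p l = m_factor \<alpha> (X (0, 0)) l ** E p l ** matrix_inv (m_factor \<alpha> (X p) l)"
  shows "local_reduced_wave_function a b j U' E' (\<lambda>p l. \<omega> p l ** matrix_inv (m_factor \<alpha> (X p) l))"
proof -
  let ?W = "\<lambda>p z. if z = 0 then mat 1 else \<omega> p (1 / z)"
  let ?\<omega>' = "\<lambda>p l. \<omega> p l ** matrix_inv (m_factor \<alpha> (X p) l)"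
  obtain V r where V: "open V" "(0, 0) \<in> V" "V \<subseteq> U" "r > 0"
    and smooth: "smooth_on (V \<times> ball 0 r) (\<lambda>(p, z). ?W p z)"
    and hol: "\<And>p. p \<in> V \<Longrightarrow> matrix_holomorphic_on (?W p) (ball 0 r)"
    and inv: "\<And>p l. p \<in> V \<Longrightarrow> norm l > 1 / r \<Longrightarrow> invertible (\<omega> p l)"
    and E: "\<And>p l. p \<in> V \<Longrightarrow> norm l > 1 / r \<Longrightarrow> E p l = matrix_inv (\<omega> (0, 0) l) **
          matrix_exp ((l * of_real (fst p)) *\<^sub>m a + (l ^ j * of_real (snd p)) *\<^sub>m b) ** \<omega> p l"
    using \<omega> unfolding local_reduced_wave_function_def by blast
  \<comment> \<open>The second bound keeps \<open>1 - \<alpha> z\<close> away from 0 on the disc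
    and, read at infinity, forces \<open>l \<noteq> \<alpha>\<close> for
    \<open>norm l > 1 / r'\<close>.\<close>
  define r' where "r' = min r (1 / (norm \<alpha> + 1))"
  have norm\<alpha>: "norm \<alpha> + 1 > 0" by (simp add: add_nonneg_pos)
  then have r': "r' > 0" "r' \<le> r" "r' \<le> 1 / (norm \<alpha> + 1)" using V(4) by (simp_all add: r'_def)
  define V' where "V' = V \<inter> U'"
  have V': "open V'" "(0, 0) \<in> V'" "V' \<subseteq> V" "V' \<subseteq> U'" using V U' by (auto simp: V'_def)
  have nz: "1 - \<alpha> * z \<noteq> 0" if "z \<in> ball 0 r'" for z
  proof
    assume "1 - \<alpha> * z = 0"
    then have "norm \<alpha> * norm z = 1" by (metis eq_iff_diff_eq_0 norm_mult norm_one)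
    moreover have "norm z \<le> 1 / (norm \<alpha> + 1)" using that r'(3) by simp
    then have "(norm \<alpha> + 1) * norm z \<le> 1" using norm\<alpha> by (simp add: field_simps)
    ultimately have "norm z = 0" by (simp add: algebra_simps)
    with \<open>norm \<alpha> * norm z = 1\<close> show False by simp
  qed
  let ?c = "\<lambda>z. z * inverse (1 - \<alpha> * z)"
  have eq: "(if z = 0 then mat 1 else ?\<omega>' p (1 / z)) = ?W p z ** (mat 1 - ?c z *\<^sub>m X p)"
    if "p \<in> V'" "z \<in> ball 0 r'" for p z
  proof (cases "z = 0")
    case False
    have "1 / (1 / z - \<alpha>) = ?c z"
      using False nz[OF that(2)] by (simp add: field_simps)
    moreover have "p \<in> U'" using that V'(4) by auto
    ultimately show ?thesis using False by (simp add: m_factor_inverse(1)[OF X(2)])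
  qed simp
  have op: "open (V' \<times> ball (0::complex) r')" using V' by (simp add: open_Times)
  have "smooth_on (V' \<times> ball 0 r') (\<lambda>q. case q of (p, z) \<Rightarrow> ?W p z)"
    by (rule smooth_on_subset[OF smooth]) (use V' r' in auto)
  then have W: "smooth_on (V' \<times> ball 0 r') (\<lambda>q. ?W (fst q) (snd q))"
    by (simp add: case_prod_unfold)
  have snd: "smooth_on (V' \<times> ball (0::complex) r') snd"
    by (rule smooth_on_bounded_linear[OF bounded_linear_snd op])
  have "smooth_on (V' \<times> ball 0 r') (\<lambda>q. inverse (1 - \<alpha> * snd q))"
    unfolding smooth_on_def
    by (rule allI, rule Ck_on_inverse[OF op])
       (use nz in \<open>auto intro!: smooth_on_Ck[OF smooth_on_diff[OF op smooth_on_const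
          smooth_on_bilinear[OF bounded_bilinear_mult op smooth_on_const snd]]]\<close>)
  from smooth_on_bilinear[OF bounded_bilinear_mult op snd this]
  have "smooth_on (V' \<times> ball 0 r') (\<lambda>q. mat 1 - ?c (snd q) *\<^sub>m X (fst q))"
    by (rule smooth_on_diff[OF op smooth_on_const smooth_on_cscale[OF op _
          smooth_on_fst[OF V'(1) open_ball smooth_on_subset[OF X(1) V'(4)]]]])
  from smooth_on_mult[OF op W this]
  have "smooth_on (V' \<times> ball 0 r') (\<lambda>(p, z). if z = 0 then mat 1 else ?\<omega>' p (1 / z))"
  proof (rule smooth_on_cong[OF op, rotated])
    fix q :: "(real \<times> real) \<times> complex" assume "q \<in> V' \<times> ball 0 r'"
    then show "?W (fst q) (snd q) ** (mat 1 - ?c (snd q) *\<^sub>m X (fst q)) =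
        (case q of (p, z) \<Rightarrow> if z = 0 then mat 1 else ?\<omega>' p (1 / z))"
      using eq[of "fst q" "snd q", symmetric] by (simp only: case_prod_unfold mem_Times_iff)
  qed
  moreover have "matrix_holomorphic_on (\<lambda>z. if z = 0 then mat 1 else ?\<omega>' p (1 / z)) (ball 0 r')"
    if p: "p \<in> V'" for p
  proof -
    have "?c holomorphic_on ball 0 r'"
      using nz by (auto intro!: holomorphic_intros)
    then have "matrix_holomorphic_on (\<lambda>z. ?c z *\<^sub>m X p) (ball 0 r')"
      by (simp add: matrix_holomorphic_on_def holomorphic_on_mult)
    moreover have "matrix_holomorphic_on (?W p) (ball 0 r')"
      using hol[of p] p V'(3) r' unfolding matrix_holomorphic_on_def
      by (meson holomorphic_on_subset subset_ball subsetD)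
    ultimately have "matrix_holomorphic_on (\<lambda>z. ?W p z ** (mat 1 - ?c z *\<^sub>m X p)) (ball 0 r')"
      by (intro matrix_holomorphic_mult matrix_holomorphic_diff matrix_holomorphic_const)
    then show ?thesis
      by (rule matrix_holomorphic_transform) (rule eq[OF p, symmetric])
  qed
  moreover have "invertible (?\<omega>' p l) \<and> E' p l = matrix_inv (?\<omega>' (0, 0) l) **
      matrix_exp ((l * of_real (fst p)) *\<^sub>m a + (l ^ j * of_real (snd p)) *\<^sub>m b) ** ?\<omega>' p l"
    if p: "p \<in> V'" and l: "norm l > 1 / r'" for p l
  proof -
    have "1 / r \<le> 1 / r'" "norm \<alpha> + 1 \<le> 1 / r'"
      using r' V(4) norm\<alpha> by (simp_all add: frac_le field_simps)
    then have l': "norm l > 1 / r" "l \<noteq> \<alpha>" using l by auto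
    have p': "p \<in> V" "p \<in> U'" "(0, 0) \<in> V" using p V' by auto
    note m = m_factor_inverse(2)[OF X(2)]
    have "matrix_inv (?\<omega>' (0, 0) l) = m_factor \<alpha> (X (0, 0)) l ** matrix_inv (\<omega> (0, 0) l)"
      using matrix_inv_mult[OF inv[OF p'(3) l'(1)] invertible_matrix_inv[OF m[OF U'(2)]]]
        matrix_inv_unique[OF matrix_inv_left[OF m[OF U'(2)]] matrix_inv_right[OF m[OF U'(2)]]]
      by simp
    moreover have "invertible (?\<omega>' p l)"
      by (rule invertible_mult[OF inv[OF p'(1) l'(1)] invertible_matrix_inv[OF m[OF p'(2)]]])
    ultimately show ?thesis
      by (simp add: E'[OF p'(2) l'(2)] E[OF p'(1) l'(1)] matrix_mul_assoc)
  qed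
  ultimately show ?thesis
    unfolding local_reduced_wave_function_def using V'(1,2,4) r'(1) by blast
qed

text \<open>The product formula is stated off the pole \<open>\<alpha>\<close>; holomorphy of
  \<open>E'\<close>, contained in \<open>trivialization\<close>, determines the value at
  \<open>\<alpha>\<close>.\<close>

theorem proposition5p2:
  fixes a b N :: "complex^'n^'n" and j :: nat and \<alpha> :: complex
    and U :: "(real \<times> real) set"
    and u :: "real \<times> real \<Rightarrow> complex^'n^'n"
    and Q :: "nat \<Rightarrow> real \<times> real \<Rightarrow> complex^'n^'n"
    and E \<omega> :: "real \<times> real \<Rightarrow> complex \<Rightarrow> complex^'n^'n"
  assumes a: "a \<in> sl" "a \<noteq> 0" "\<forall>i k. i \<noteq> k \<longrightarrow> a $ i $ k = 0"
    and b: "b \<in> sl" "commutator a b = 0"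
    and j: "j > 0"
    and u: "local_solution a b j U u Q"
    and E: "trivialization a b j U u Q E"
    and \<omega>: "local_reduced_wave_function a b j U E \<omega>"
    and N: "N ** N = 0"
  defines "U' \<equiv> N_tilde_domain \<alpha> N E U"
    and "N' \<equiv> N_tilde \<alpha> N E"
  defines "u' \<equiv> (\<lambda>p. u p - commutator a (N' p))"
    and "\<omega>' \<equiv> (\<lambda>p l. \<omega> p l ** matrix_inv (m_factor \<alpha> (N' p) l))"
  shows "\<exists>Q' E'.
    local_solution a b j U' u' Q' \<and>
    trivialization a b j U' u' Q' E' \<and>
    (\<forall>p\<in>U'. \<forall>l. l \<noteq> \<alpha> \<longrightarrow>
      E' p l = m_factor \<alpha> N l ** E p l ** matrix_inv (m_factor \<alpha> (N' p) l)) \<and>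
    local_reduced_wave_function a b j U' E' \<omega>'"
proof -
  have U: "open U" "(0, 0) \<in> U" and smooth_u: "smooth_on U u"
    and u_perp: "\<And>p. p \<in> U \<Longrightarrow> u p \<in> sl_perp a"
    and smooth_Q: "\<And>i. smooth_on U (Q i)"
    and Q_0: "\<And>p. p \<in> U \<Longrightarrow> Q 0 p = b"
    and Q_sl: "\<And>i p. p \<in> U \<Longrightarrow> Q i p \<in> sl"
    and Q_x: "\<And>i p. p \<in> U \<Longrightarrow> dx (Q i) p + commutator (u p) (Q i p) = commutator (Q (Suc i) p) a"
    and Q_conj: "\<And>p. p \<in> U \<Longrightarrow> formally_conjugate (\<lambda>i. Q i p) b"
    and u_t: "\<And>p. p \<in> U \<Longrightarrow> dt u p = dx (Q j) p + commutator (u p) (Q j p)"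
    using u unfolding local_solution_def Q_family_def by auto
  have smooth_E: "smooth_on (U \<times> UNIV) (\<lambda>(p, l). E p l)"
    and hol_E: "\<And>p. p \<in> U \<Longrightarrow> matrix_holomorphic_on (E p) UNIV"
    and inv_E: "\<And>p l. p \<in> U \<Longrightarrow> invertible (E p l)"
    and E_dx: "\<And>p l. p \<in> U \<Longrightarrow> matrix_inv (E p l) ** dx (\<lambda>q. E q l) p = l *\<^sub>m a + u p"
    and E_dt: "\<And>p l. p \<in> U \<Longrightarrow> matrix_inv (E p l) ** dt (\<lambda>q. E q l) p =
        l ^ j *\<^sub>m b + (\<Sum>i = 1..j. l ^ (j - i) *\<^sub>m Q i p)"
    and E_0: "\<And>l. E (0, 0) l = mat 1"
    using E unfolding trivialization_def by auto

  \<comment> \<open>The domain of the new nilpotent matrix\<close>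
  interpret F: holomorphic_family U E
    by unfold_locales (use U smooth_E hol_E in auto)
  have gauge_eq: "(mat 1 + N ** E1 \<alpha> E p) ** E p \<alpha> = E p \<alpha> + N ** matrix_deriv (E p) \<alpha>" if "p \<in> U" for p
  proof -
    have "E1 \<alpha> E p ** E p \<alpha> = matrix_deriv (E p) \<alpha>"
      using that by (simp add: E1_def matrix_deriv_mult_const[OF hol_E] matrix_inv_left[OF inv_E]
          flip: matrix_mul_assoc)
    then show ?thesis by (simp add: matrix_add_rdistrib flip: matrix_mul_assoc)
  qed
  \<comment> \<open>As the nonvanishing set of a continuous determinant the domain will be
    open.\<close>
  have U'_eq: "U' = U \<inter> (\<lambda>p. det (E p \<alpha> + N ** matrix_deriv (E p) \<alpha>)) -` (- {0})"
  proof -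
    have "invertible (mat 1 + N ** E1 \<alpha> E p) \<longleftrightarrow> det (E p \<alpha> + N ** matrix_deriv (E p) \<alpha>) \<noteq> 0"
      if "p \<in> U" for p
      using inv_E[OF that, of \<alpha>] by (simp add: det_mul invertible_det_nz flip: gauge_eq[OF that])
    then show ?thesis by (auto simp: U'_def N_tilde_domain_def)
  qed
  have U'_U: "U' \<subseteq> U" by (auto simp: U'_eq)
  have "Ck_on 0 U (\<lambda>p. det (E p \<alpha> + N ** matrix_deriv (E p) \<alpha>))"
    by (rule Ck_on_det[OF U(1) smooth_on_Ck[OF smooth_on_add[OF U(1) F.smooth_E_at
        smooth_on_mult[OF U(1) smooth_on_const F.smooth_matrix_deriv]]]])
  then have open_U': "open U'"
    unfolding U'_eq by (intro continuous_open_preimage U(1)) auto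
  interpret D: dressing U' E \<alpha> N
  proof unfold_locales
    show "smooth_on (U' \<times> UNIV) (\<lambda>(p, l). E p l)"
      by (rule smooth_on_subset[OF smooth_E]) (use U'_U in auto)
  qed (use open_U' U'_U hol_E N in \<open>auto simp: U'_eq invertible_det_nz\<close>)
  have E_00: "E (0, 0) = (\<lambda>_. mat 1)" using E_0 by auto
  have dd_0: "matrix_divided_difference \<alpha> (E (0, 0)) = (\<lambda>_. 0)"
    unfolding E_00 by (rule ext) (rule matrix_divided_difference_const)
  \<comment> \<open>\<open>E (0, 0)\<close> is constantly the identity, so its derivative in
    \<open>\<lambda>\<close> vanishes; this places the origin in \<open>U'\<close> and gives
    \<open>N' (0, 0) = N\<close>.\<close>
  have gauge_0: "D.gauge (0, 0) = mat 1"
    using fun_cong[OF dd_0, of \<alpha>] by (simp add: D.gauge_def E_0 matrix_divided_difference_at)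
  have zero_U': "(0, 0) \<in> U'"
    using gauge_0 U(2) by (simp add: U'_eq D.gauge_def)

  have N'_eq: "D.Nt p = N' p" if "p \<in> U'" for p
  proof -
    have p: "p \<in> U" "invertible (mat 1 + N ** E1 \<alpha> E p)"
      using that by (auto simp: U'_def N_tilde_domain_def)
    \<comment> \<open>Hence conjugating by the gauge leaves just the inverse of
      \<open>mat 1 + N ** E1 \<alpha> E p\<close> on the left of \<open>N\<close>, as in
      \<open>N_tilde\<close>.\<close>
    have "N ** (mat 1 + N ** E1 \<alpha> E p) = N"
      by (simp add: matrix_add_ldistrib matrix_mul_assoc N)
    then show ?thesis
      by (simp add: D.Nt_def D.gauge_def N'_def N_tilde_def matrix_inv_mult[OF p(2) inv_E[OF p(1)]]
          flip: gauge_eq[OF p(1)]) (metis matrix_mul_assoc)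
  qed
  have N'_0: "N' (0, 0) = N"
    using matrix_inv_unique[of "mat 1 :: complex^'n^'n" "mat 1"]
    by (simp add: gauge_0 D.Nt_def flip: N'_eq[OF zero_U'])
  have smooth_N': "smooth_on U' N'"
    by (rule smooth_on_cong[OF open_U' _ D.smooth_Nt]) (simp add: N'_eq)
  have N'_N': "N' p ** N' p = 0" if "p \<in> U'" for p
    using D.Nt_Nt[OF that] by (simp add: N'_eq[OF that])

  \<comment> \<open>Derivatives of the dressed objects\<close>
  define Q' where "Q' i p = dressed \<alpha> (N' p) (\<lambda>i. Q i p) i" for i p
  have Q_partial: "has_partial_derivative (1, 0) (Q i)
      (commutator (Q (Suc i) p) a - commutator (u p) (Q i p)) p" if "p \<in> U" for i p
    using smooth_on_dx[OF smooth_Q that] Q_x[OF that] by (metis add_diff_cancel_right')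
  have E_x: "has_partial_derivative (1, 0) (\<lambda>q. E q l) (E p l ** (l *\<^sub>m a + u p)) p" if "p \<in> U" for p l
    using smooth_on_dx[OF F.smooth_E_at that] E_dx[OF that] matrix_mul_eq_iff[OF inv_E[OF that]] by metis
  have E_t: "has_partial_derivative (0, 1) (\<lambda>q. E q l) (E p l ** horner l (\<lambda>i. Q i p) (Suc j)) p"
    if "p \<in> U" for p l
  proof -
    have "matrix_inv (E p l) ** dt (\<lambda>q. E q l) p = horner l (\<lambda>i. Q i p) (Suc j)"
      by (simp only: E_dt[OF that] Q_0[OF that, symmetric] horner_eq_sum[of l j "\<lambda>i. Q i p"])
    then show ?thesis
      using smooth_on_dt[OF F.smooth_E_at that] matrix_mul_eq_iff[OF inv_E[OF that]] by metis
  qed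
  have N'_x: "has_partial_derivative (1, 0) N'
      (N' p ** (\<alpha> *\<^sub>m a + u p) - (\<alpha> *\<^sub>m a + u p) ** N' p - N' p ** a ** N' p) p"
    and Et_x: "has_partial_derivative (1, 0) (\<lambda>q. D.Et q l) (D.Et p l ** (l *\<^sub>m a + u' p)) p"
    if p: "p \<in> U'" for p l
  proof -
    have pU: "p \<in> U" using p U'_U by auto
    have A: "l *\<^sub>m a + u p = (\<alpha> *\<^sub>m a + u p) + (l - \<alpha>) *\<^sub>m a" "a = a + (l - \<alpha>) *\<^sub>m 0" for l
      by (simp_all add: vec_eq_iff algebra_simps)
    note D = D.Nt_partial[OF p E_x[OF pU] A continuous_on_const]
      D.Et_partial[OF p E_x[OF pU] A continuous_on_const]
    show "has_partial_derivative (1, 0) N'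
      (N' p ** (\<alpha> *\<^sub>m a + u p) - (\<alpha> *\<^sub>m a + u p) ** N' p - N' p ** a ** N' p) p"
      using has_partial_derivative_cong[OF open_U' p N'_eq D(1)] by (simp add: N'_eq[OF p])
    show "has_partial_derivative (1, 0) (\<lambda>q. D.Et q l) (D.Et p l ** (l *\<^sub>m a + u' p)) p"
      using D(2)[of l] by (simp add: N'_eq[OF p] u'_def commutator_swap[of a] add.assoc)
  qed
  have N'_t: "has_partial_derivative (0, 1) N' (Q' (Suc j) p - Q (Suc j) p) p"
    and Et_t: "has_partial_derivative (0, 1) (\<lambda>q. D.Et q l) (D.Et p l ** horner l (\<lambda>i. Q' i p) (Suc j)) p"
    if p: "p \<in> U'" for p l
  proof -
    have pU: "p \<in> U" using p U'_U by auto
    \<comment> \<open>With \<open>Suc j\<close> coefficients, the derivative of \<open>Nt\<close>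
      consists of the correction terms of \<open>dressed\<close> at index \<open>Suc j\<close>, that
      is, \<open>Q' (Suc j) p - Q (Suc j) p\<close>.\<close>
    note D = D.Nt_partial[OF p E_t[OF pU] horner_shift horner_shift continuous_on_horner]
      D.Et_partial[OF p E_t[OF pU] horner_shift horner_shift continuous_on_horner]
    show "has_partial_derivative (0, 1) N' (Q' (Suc j) p - Q (Suc j) p) p"
      using has_partial_derivative_cong[OF open_U' p N'_eq D(1)]
      by (simp add: N'_eq[OF p] Q'_def dressed_def commutator_def algebra_simps del: horner.simps)
    show "has_partial_derivative (0, 1) (\<lambda>q. D.Et q l) (D.Et p l ** horner l (\<lambda>i. Q' i p) (Suc j)) p"
      using D(2)[of l] by (simp add: N'_eq[OF p] Q'_def horner_dressed del: horner.simps)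
  qed

  have smooth_Q': "smooth_on U' (Q' i)" for i
    unfolding Q'_def
    by (rule smooth_on_dressed[OF open_U' smooth_N' smooth_on_subset[OF smooth_Q U'_U]])
  have smooth_u': "smooth_on U' u'"
    unfolding u'_def
    by (rule smooth_on_diff[OF open_U' smooth_on_subset[OF smooth_u U'_U]
        smooth_on_commutator[OF open_U' smooth_on_const smooth_N']])
  have Q'_x: "has_partial_derivative (1, 0) (Q' i)
      (commutator (Q' (Suc i) p) a - commutator (u' p) (Q' i p)) p" if p: "p \<in> U'" for i p
  proof -
    have pU: "p \<in> U" using p U'_U by auto
    have "commutator (Q 0 p) a = 0"
      using b(2) commutator_swap[of b a] by (simp add: Q_0[OF pU])
    from dressed_partial[where A = Q, OF Q_partial[OF pU] this N'_N'[OF p] N'_x[OF p], of i]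
    show ?thesis by (simp only: Q'_def[abs_def] u'_def)
  qed
  \<comment> \<open>\<open>u\<close> moves by \<open>[Q (Suc j), a]\<close>, and the correction
    replaces \<open>Q (Suc j)\<close> by \<open>Q' (Suc j)\<close>; the recursion at index
    \<open>j\<close> then turns this into the flow equation.\<close>
  have u'_t: "dt u' p = commutator (Q' (Suc j) p) a" if p: "p \<in> U'" for p
  proof -
    have pU: "p \<in> U" using p U'_U by auto
    have "has_partial_derivative (0, 1) u (commutator (Q (Suc j) p) a) p"
      using smooth_on_dt[OF smooth_u pU] by (simp add: u_t[OF pU] Q_x[OF pU])
    from dt_eq[OF has_partial_derivative_diff[OF this
        has_partial_derivative_commutator_const[OF N'_t[OF p], of a]]]
    show ?thesis
      unfolding u'_def by (simp add: commutator_diff_right commutator_swap[of a])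
  qed

  \<comment> \<open>The new solution of the flow\<close>
  have "Q_family a b U' u' Q'"
    unfolding Q_family_def
  proof (intro conjI ballI allI smooth_Q')
    fix p i assume p: "p \<in> U'"
    then have pU: "p \<in> U" using U'_U by auto
    show "Q' 0 p = b" by (simp add: Q'_def dressed_0 Q_0[OF pU])
    show "Q' i p \<in> sl"
      using Q_sl[OF pU] trace_dressed[OF N'_N'[OF p]] by (simp add: sl_def Q'_def)
    show "dx (Q' i) p + commutator (u' p) (Q' i p) = commutator (Q' (Suc i) p) a"
      using dx_eq[OF Q'_x[OF p]] by simp
    show "formally_conjugate (\<lambda>i. Q' i p) b"
      using formally_conjugate_dressed[OF N'_N'[OF p] Q_conj[OF pU]] by (simp add: Q'_def)
  qed
  moreover have "u' p \<in> sl_perp a" if "p \<in> U'" for p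
    unfolding u'_def by (rule sl_perp_diff_commutator[OF u_perp]) (use that U'_U in blast)
  moreover have "dt u' p = dx (Q' j) p + commutator (u' p) (Q' j p)" if "p \<in> U'" for p
    using u'_t[OF that] dx_eq[OF Q'_x[OF that]] by simp
  ultimately have sol: "local_solution a b j U' u' Q'"
    using open_U' zero_U' smooth_u' by (simp add: local_solution_def)

  \<comment> \<open>Its trivialization\<close>
  have "invertible (D.Et p l)" if "p \<in> U'" for p l
    using D.det_Et[OF that] inv_E[of p l] that U'_U by (auto simp: invertible_det_nz)
  moreover have "dx (\<lambda>q. D.Et q l) p = D.Et p l ** (l *\<^sub>m a + u' p)" if "p \<in> U'" for p l
    by (rule dx_eq[OF Et_x[OF that]])
  moreover have "dt (\<lambda>q. D.Et q l) p =
      D.Et p l ** (l ^ j *\<^sub>m b + (\<Sum>i = 1..j. l ^ (j - i) *\<^sub>m Q' i p))" if p: "p \<in> U'" for p l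
  proof -
    have "p \<in> U" using p U'_U by auto
    then have "Q' 0 p = b" by (simp add: Q'_def dressed_0 Q_0)
    then show ?thesis
      using horner_eq_sum[of l j "\<lambda>i. Q' i p"] dt_eq[OF Et_t[OF p, of l]] by simp
  qed
  moreover have "D.Et (0, 0) l = mat 1" for l
    by (simp add: D.Et_def E_0 dd_0 matrix_divided_difference_const)
  ultimately have triv: "trivialization a b j U' u' Q' D.Et"
    using D.smooth_Et D.holomorphic_Et by (simp add: trivialization_def matrix_mul_eq_iff)

  \<comment> \<open>Its reduced wave function\<close>
  have Et: "D.Et p l = m_factor \<alpha> N l ** E p l ** matrix_inv (m_factor \<alpha> (N' p) l)"
    if "p \<in> U'" "l \<noteq> \<alpha>" for p l
    using D.Et_eq[OF that] m_factor_inverse(1)[OF N'_N'[OF that(1)]]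
    by (simp add: N'_eq[OF that(1)] m_factor_def)
  have "local_reduced_wave_function a b j U' D.Et \<omega>'"
    unfolding \<omega>'_def
    by (rule local_reduced_wave_function_dressing[OF \<omega> open_U' zero_U' smooth_N' N'_N'])
       (simp_all add: N'_0 Et)
  with sol triv Et show ?thesis by blast
qed

end
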